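(* For every integer $k\ge 1$ and every integer $n\ge 0$, $$B_3\big(2^{k+1}n+2^k-1\big)=\frac{2^{2k+2}+(-1)^k}{5}\cdot B_3(2n),$$ $$B_3\big(2^{k+1}n+2^{k+1}-1\big)=\frac{2^{2k+2}+(-1)^k}{5}\cdot B_3(2n+1)+\frac{2^{2k+2}-4(-1)^k}{5}\cdot B_3(n).$$
   Context: A partition is a 3-core if none of its hook numbers is a multiple of 3 (the empty partition is a 3-core). For an integer $n\ge 0$, $B_3(n)$ denotes the number of partition triples of $n$ with 3-cores, i.e. ordered triples $(\lambda_1,\lambda_2,\lambda_3)$ of (possibly empty) partitions, each a 3-core, such that the sum of all the parts of $\lambda_1,\lambda_2,\lambda_3$ equals $n$; in particular $B_3(0)=1$. Equivalently (a standard fact recalled in the paper), $\sum_{n\ge 0}B_3(n)q^n=\dfrac{f_3^9}{f_1^3}$, where $f_k=\prod_{m=1}^{\infty}(1-q^{km})$. *)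

theory Defs
  imports Complex_Main
begin

text \<open>A partition is the weakly decreasing list of its (positive) parts.\<close>

definition is_partition :: "nat list \<Rightarrow> bool" where
  "is_partition p \<longleftrightarrow> sorted_wrt (\<ge>) p \<and> 0 \<notin> set p"

text \<open>Rows and columns of the Young diagram are indexed from 0.\<close>

definition young_diagram :: "nat list \<Rightarrow> (nat \<times> nat) set" where
  "young_diagram p = {(i, j). i < length p \<and> j < p ! i}"

text \<open>The hook of a cell: the cell itself, the cells to its right in the same row (arm)
  and the cells below it in the same column (leg).\<close>

definition hook :: "nat list \<Rightarrow> nat \<Rightarrow> nat \<Rightarrow> (nat \<times> nat) set" where
  "hook p i j =
     {(i', j') \<in> young_diagram p. (i' = i \<and> j \<le> j') \<or> (i \<le> i' \<and> j' = j)}"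

definition hook_number :: "nat list \<Rightarrow> nat \<Rightarrow> nat \<Rightarrow> nat" where
  "hook_number p i j = card (hook p i j)"

definition is_core :: "nat \<Rightarrow> nat list \<Rightarrow> bool" where
  "is_core t p \<longleftrightarrow>
     is_partition p \<and> (\<forall>(i, j) \<in> young_diagram p. \<not> t dvd hook_number p i j)"

definition core3_triples :: "nat \<Rightarrow> (nat list \<times> nat list \<times> nat list) set" where
  "core3_triples n =
     {(p1, p2, p3). is_core 3 p1 \<and> is_core 3 p2 \<and> is_core 3 p3 \<and>
        sum_list p1 + sum_list p2 + sum_list p3 = n}"

definition B3 :: "nat \<Rightarrow> nat" where
  "B3 n = card (core3_triples n)"

lemma length_le_sum_list_partition: "is_partition p \<Longrightarrow> length p \<le> sum_list p"
proof (induction p)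
  case (Cons a p)
  then show ?case by (cases a) (auto simp: is_partition_def)
qed (simp add: is_partition_def)

text \<open>In particular the cardinality in the definition of \<^const>\<open>B3\<close> is a genuine count.\<close>

lemma finite_core3_triples: "finite (core3_triples n)"
proof -
  define L where "L = {p :: nat list. set p \<subseteq> {..n} \<and> length p \<le> n}"
  have "finite L"
    unfolding L_def by (rule finite_lists_length_le) simp
  moreover have "p \<in> L" if "is_core t p" "sum_list p \<le> n" for t p
    using that length_le_sum_list_partition[of p] member_le_sum_list[of _ p]
    by (fastforce simp: L_def is_core_def)
  then have "core3_triples n \<subseteq> L \<times> L \<times> L"
    by (auto simp: core3_triples_def)
  ultimately show ?thesis
    by (meson finite_SigmaI finite_subset)
qed

lemma is_core_Nil: "is_core t []"
  by (simp add: is_core_def is_partition_def young_diagram_def)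

lemma B3_0: "B3 0 = 1"
proof -
  have "p = []" if "is_core t p" "sum_list p = 0" for t p
  proof -
    have "length p \<le> sum_list p"
      using that by (intro length_le_sum_list_partition) (simp add: is_core_def)
    with that show ?thesis by (metis le_zero_eq length_0_conv)
  qed
  then have "core3_triples 0 = {([], [], [])}"
    by (auto simp: core3_triples_def is_core_Nil)
  then show ?thesis by (simp add: B3_def)
qed

end

theory Submission
  imports Defs "HOL-Complex_Analysis.Cauchy_Integral_Formula"
begin

text \<open>Put \<open>a m = B3 (m - 1)\<close> for \<open>m > 0\<close>.  Both identities are statements about \<open>a (2 ^ j * m)\<close>, and
they follow by solving a linear recurrence once it is known that
  \<open>a (2 * m) = 3 * a m + 4 * a (m / 2)\<close>,
where the last term is present only for even \<open>m\<close> (lemma \<open>B3_pred_hecke\<close>).  In the language of modular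
forms this says that the Eisenstein series \<open>\<Sum> a m * q ^ m\<close> of weight 3 and level 3 is an eigenform of
the Hecke operator at 2.  The proof below needs no modular forms; it works with convergent series
of a real variable.

From cores to a quadratic form.  On an abacus with three runners, the beta numbers of a 3-core fill
an initial segment of runner 1 and of runner 2 and leave runner 0 empty.  A 3-core is therefore
the same thing as the pair \<open>(a, b)\<close> of the two filling heights, and its size is
\<open>a\<^sup>2 - a * b + b\<^sup>2 + b\<close>.  Three times the size plus one is the value \<open>N (a, b)\<close> of
\<open>hex_form\<close>, which is the norm form of the Eisenstein integers on a residue class modulo the
square root of -3.  The form \<open>N\<close> makes sense on
the whole plane of integers, where it is invariant under a rotation of order three that has the quadrant
\<open>a, b \<ge> 0\<close> as a fundamental domain.  With \<open>H g\<close> the sum of \<open>g ^ N v\<close> over all lattice points this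
gives \<open>\<Sum> a m * g ^ (3 * m) = (H g / 3) ^ 3\<close>, and comparing coefficients turns the recurrence into
  \<open>H h ^ 3 + H (- h) ^ 3 = 6 * H (h\<^sup>2) ^ 3 + 8 * H (h ^ 4) ^ 3\<close>
(lemma \<open>hex_series_cubes\<close>).

The identity for \<open>H\<close>.  Let \<open>h = s ^ 4\<close> and let \<open>x\<close>, \<open>p\<close>, \<open>y\<close> be the sums of \<open>s ^ (3 * w\<^sup>2)\<close> over odd
\<open>w\<close>, of \<open>s ^ w\<^sup>2\<close> over \<open>w\<close> congruent to 1 modulo 6, and of \<open>s ^ w\<^sup>2\<close> over \<open>w\<close> congruent to 3 modulo 6.
An even value of \<open>N\<close> is four times a value of \<open>N\<close>, which settles the even part of \<open>H\<close>.  The rest follows by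
elimination from four relations:
  \<open>3 * p\<^sup>2 * y = x * H (s ^ 8)\<close>,
  \<open>3 * x * p = 2 * (H (s ^ 4) - H (s ^ 16))\<close>,
  \<open>x ^ 4 = 8 * p ^ 3 * y + y ^ 4\<close>,
  \<open>2 * p2\<^sup>2 * y2 * x = x2 * p * y\<^sup>2\<close>,
where \<open>x2\<close>, \<open>p2\<close>, \<open>y2\<close> are the same series at \<open>s\<^sup>2\<close>.  The first three express linear changes of variables
between lattices; the third one is multiplication by the quaternion \<open>i + j + k\<close> of norm 3.  The last one is of a
different nature, because the quadratic forms on its two sides are not equivalent over the
rationals: it is read off from the infinite products that the Jacobi triple product
gives for \<open>x\<close>, \<open>p\<close> and \<open>y\<close>.\<close>

section \<open>Theta series\<close>

lemma has_sum_times: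
  fixes f :: "'a \<Rightarrow> real" and g :: "'b \<Rightarrow> real"
  assumes f: "(f has_sum a) A" and g: "(g has_sum b) B"
  shows "((\<lambda>(x, y). f x * g y) has_sum a * b) (A \<times> B)"
proof (rule has_sum_SigmaI[where g = "\<lambda>x. f x * b"])
  show "((\<lambda>y. case (x, y) of (x, y) \<Rightarrow> f x * g y) has_sum f x * b) B" for x
    using has_sum_cmult_right[OF g, of "f x"] by simp
  show "((\<lambda>x. f x * b) has_sum a * b) A"
    using has_sum_cmult_left[OF f, of b] by simp
  have fA: "(\<lambda>x. \<bar>f x\<bar>) summable_on A" and gB: "(\<lambda>y. \<bar>g y\<bar>) summable_on B"
    using has_sum_imp_summable[OF f] has_sum_imp_summable[OF g]
      summable_on_iff_abs_summable_on_real[of f A] summable_on_iff_abs_summable_on_real[of g B]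
    by simp_all
  have "(\<lambda>z. norm (case z of (x, y) \<Rightarrow> f x * g y)) summable_on A \<times> B"
    unfolding Infinite_Sum.abs_summable_on_Sigma_iff
  proof (intro conjI ballI)
    show "(\<lambda>y. norm (case (x, y) of (x, y) \<Rightarrow> f x * g y)) summable_on B" for x
      using summable_on_cmult_right[OF gB, of "\<bar>f x\<bar>"] by (simp add: abs_mult)
    show "(\<lambda>x. norm (\<Sum>\<^sub>\<infinity>y\<in>B. norm (case (x, y) of (x, y) \<Rightarrow> f x * g y))) summable_on A"
      using summable_on_cmult_left[OF fA, of "\<Sum>\<^sub>\<infinity>y\<in>B. \<bar>g y\<bar>"]
      by (simp add: abs_mult infsum_cmult_right' infsum_nonneg)
  qed
  then show "(\<lambda>(x, y). f x * g y) summable_on A \<times> B"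
    by (rule abs_summable_summable)
qed

text \<open>Unlike in the classical notation, linear terms and fractional powers of the nome are avoided by completing the
square, so that a product of such series is the generating function of a plain sum of squares.\<close>

definition theta :: "int \<Rightarrow> int \<Rightarrow> real \<Rightarrow> real" where
  "theta m r s = (\<Sum>\<^sub>\<infinity>i\<in>UNIV. s powi ((m * i + r)\<^sup>2))"

lemma summable_powi_square:
  fixes s :: real
  assumes "0 < s" "s < 1"
  shows "(\<lambda>n::int. s powi (n\<^sup>2)) summable_on UNIV"
proof -
  have sn: "(\<lambda>n::nat. s powi ((int n)\<^sup>2)) summable_on UNIV"
  proof (rule summable_on_comparison_test)
    show "(\<lambda>n. s ^ n) summable_on UNIV"
      using assms by (intro norm_summable_imp_summable_on) (simp add: summable_geometric)
    show "s powi ((int n)\<^sup>2) \<le> s ^ n" for n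
    proof -
      have "s powi ((int n)\<^sup>2) = s ^ (n\<^sup>2)"
        by (metis of_nat_power power_int_of_nat)
      also have "\<dots> \<le> s ^ n"
        using assms by (intro power_decreasing) (auto simp: power2_eq_square)
      finally show ?thesis .
    qed
    show "0 \<le> s powi ((int n)\<^sup>2)" for n using assms by simp
  qed
  have "(\<lambda>n::int. s powi (n\<^sup>2)) summable_on {0..}"
    using sn by (subst summable_on_reindex_bij_witness[where i = int and j = nat and
        T = UNIV and h = "\<lambda>n::nat. s powi ((int n)\<^sup>2)"]) auto
  moreover have "(\<lambda>n::int. s powi (n\<^sup>2)) summable_on {..0}"
    using sn by (subst summable_on_reindex_bij_witness[where i = "\<lambda>n. - int n" and
        j = "\<lambda>n. nat (- n)" and
        T = UNIV and h = "\<lambda>n::nat. s powi ((int n)\<^sup>2)"]) auto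
  ultimately have "(\<lambda>n::int. s powi (n\<^sup>2)) summable_on ({0..} \<union> {..0})"
    by (rule summable_on_union)
  moreover have "{0..} \<union> {..0::int} = UNIV" by auto
  ultimately show ?thesis by simp
qed

lemma has_sum_theta:
  assumes "0 < s" "s < 1" "m \<noteq> 0"
  shows "((\<lambda>i. s powi ((m * i + r)\<^sup>2)) has_sum theta m r s) UNIV"
proof -
  have "inj (\<lambda>i. m * i + r)" using assms by (auto intro: injI)
  moreover have "(\<lambda>n. s powi (n\<^sup>2)) summable_on range (\<lambda>i. m * i + r)"
    by (rule summable_on_subset[OF summable_powi_square]) (use assms in auto)
  ultimately have "(\<lambda>i. s powi ((m * i + r)\<^sup>2)) summable_on UNIV"
    by (subst (asm) summable_on_reindex) (auto simp: o_def)
  then show ?thesis by (simp add: theta_def has_sum_infsum)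
qed

lemma theta_pos:
  assumes "0 < s" "s < 1" "m \<noteq> 0"
  shows "0 < theta m r s"
proof -
  have "s powi ((m * 0 + r)\<^sup>2) \<le> theta m r s"
    using finite_sum_le_has_sum[OF has_sum_theta[OF assms, of r], of "{0}"] assms by simp
  moreover have "0 < s powi ((m * 0 + r)\<^sup>2)" using assms by simp
  ultimately show ?thesis by linarith
qed

lemma theta_shift: "theta m (r + m) s = theta m r s"
proof -
  have "m * i + (r + m) = m * (i + 1) + r" for i by (simp add: distrib_left)
  then show ?thesis
    unfolding theta_def
    by (intro infsum_reindex_bij_witness[where i = "\<lambda>i. i - 1" and j = "\<lambda>i. i + 1"])
       (simp_all add: distrib_left add_ac)
qed

lemma theta_uminus: "theta m (- r) s = theta m r s"
  unfolding theta_def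
  by (rule infsum_reindex_bij_witness[where i = uminus and j = uminus])
     (auto simp: power2_eq_square algebra_simps)

section \<open>The hexagonal norm form\<close>

definition hex_form :: "int \<times> int \<Rightarrow> int" where
  "hex_form = (\<lambda>(a, b). 3 * (a\<^sup>2 - a * b + b\<^sup>2 + b) + 1)"

text \<open>The rotation of order three about \<open>(- 1 / 3, - 2 / 3)\<close>, the point where the quadratic
polynomial \<open>hex_form\<close> is minimal.\<close>

definition rot :: "int \<times> int \<Rightarrow> int \<times> int" where
  "rot = (\<lambda>(a, b). (- b - 1, a - b - 1))"

definition hex_series :: "real \<Rightarrow> real" where
  "hex_series g = (\<Sum>\<^sub>\<infinity>v\<in>UNIV. g powi hex_form v)"

lemma hex_form_rot: "hex_form (rot v) = hex_form v"
  by (cases v) (simp add: hex_form_def rot_def power2_eq_square algebra_simps)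

lemma rot_rot_rot: "rot (rot (rot v)) = v"
  by (cases v) (simp add: rot_def)

lemma inj_rot: "inj_on rot A"
  by (metis inj_onI rot_rot_rot)

lemma rot_image: "rot ` A = {v. rot (rot v) \<in> A}"
proof (intro set_eqI iffI)
  fix v assume "v \<in> {v. rot (rot v) \<in> A}"
  then have "rot (rot (rot v)) \<in> rot ` A" by blast
  then show "v \<in> rot ` A" by (simp only: rot_rot_rot)
qed (auto simp: rot_rot_rot)

text \<open>With the sign of the last one reversed, the three linear forms have sum zero and are permuted cyclically by
\<^const>\<open>rot\<close>. They are the coordinates in which the substitutions between lattices become
visible.\<close>

lemma hex_form_squares:
  "2 * hex_form (a, b) = (2 * a - b)\<^sup>2 + (2 * b - a + 1)\<^sup>2 + (a + b + 1)\<^sup>2"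
  by (simp add: hex_form_def power2_eq_square algebra_simps)

lemma hex_form_pos: "0 < hex_form v"
proof (cases v)
  case (Pair a b)
  have "0 < 2 * hex_form (a, b)" 
  proof (rule ccontr)
    assume "\<not> ?thesis"
    then have "(2 * a - b)\<^sup>2 = 0" "(2 * b - a + 1)\<^sup>2 = 0" "(a + b + 1)\<^sup>2 = 0"
      unfolding hex_form_squares using zero_le_power2[of "2 * a - b"] zero_le_power2[of "2 * b - a + 1"]
        zero_le_power2[of "a + b + 1"] by linarith+
    then show False by (simp add: power2_eq_square) presburger
  qed
  then show ?thesis using Pair by simp
qed

lemma has_sum_hex_series:
  assumes "\<bar>g\<bar> < 1"
  shows "((\<lambda>v. g powi hex_form v) has_sum hex_series g) UNIV"
proof (cases "g = 0")
  case True
  have "(0::real) powi hex_form v = 0" for v using hex_form_pos[of v] by (simp add: power_int_0_left_if)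
  then show ?thesis using True by (simp add: hex_series_def)
next
  case False
  define t where "t = sqrt \<bar>g\<bar>"
  have t: "0 < t" "t < 1" "\<bar>g\<bar> = t powi 2" using assms False by (auto simp: t_def)
  have inj: "inj (\<lambda>(a, b). (2 * a - b, 2 * b - a + 1 :: int))"
    by (rule injI) (auto simp: algebra_simps)
  note sq = has_sum_infsum[OF summable_powi_square[OF t(1,2)]]
  have "(\<lambda>(x, y). t powi (x\<^sup>2) * t powi (y\<^sup>2)) summable_on UNIV \<times> UNIV"
    by (rule has_sum_imp_summable[OF has_sum_times[OF sq sq]])
  then have "(\<lambda>(x, y). t powi (x\<^sup>2) * t powi (y\<^sup>2)) summable_on
      range (\<lambda>(a, b). (2 * a - b, 2 * b - a + 1))"
    by (rule summable_on_subset) auto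
  then have "((\<lambda>(x, y). t powi (x\<^sup>2) * t powi (y\<^sup>2)) \<circ> (\<lambda>(a, b). (2 * a - b, 2 * b - a + 1)))
      summable_on UNIV"
    using summable_on_reindex[OF inj] by blast
  then have "(\<lambda>v. norm (g powi hex_form v)) summable_on UNIV"
  proof (rule Infinite_Sum.abs_summable_on_comparison_test')
    fix v :: "int \<times> int"
    obtain a b where v: "v = (a, b)" by (cases v)
    have "norm (g powi hex_form v) = (t powi 2) powi hex_form v"
      by (simp only: real_norm_def power_int_abs t(3))
    also have "\<dots> = t powi (2 * hex_form v)"
      by (simp add: power_int_mult)
    also have "2 * hex_form v = (2 * a - b)\<^sup>2 + (2 * b - a + 1)\<^sup>2 + (a + b + 1)\<^sup>2"
      unfolding v by (rule hex_form_squares)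
    also have "t powi \<dots> = t powi ((2 * a - b)\<^sup>2) * t powi ((2 * b - a + 1)\<^sup>2) * t powi ((a + b + 1)\<^sup>2)"
      using t by (simp add: power_int_add)
    also have "\<dots> \<le> t powi ((2 * a - b)\<^sup>2) * t powi ((2 * b - a + 1)\<^sup>2) * 1"
      using t by (intro mult_left_mono power_int_le_one) auto
    finally show "norm (g powi hex_form v) \<le> ((\<lambda>(x, y). t powi (x\<^sup>2) * t powi (y\<^sup>2)) \<circ> (\<lambda>(a, b). (2 * a - b, 2 * b - a + 1))) v"
      by (simp add: v)
  qed
  then show ?thesis
    unfolding hex_series_def by (intro has_sum_infsum) (rule abs_summable_summable)
qed

text \<open>An invariant sum is divided equally among the three images of a fundamental domain of the rotation.  So sums
over two fundamental domains as different as a quadrant and a residue class agree, and no bijection between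
them is needed.\<close>

lemma has_sum_rot_fundamental_domain:
  fixes f :: "int \<times> int \<Rightarrow> real"
  assumes f: "(f has_sum T) U" and inv: "\<And>v. f (rot v) = f v"
    and U: "U = D \<union> rot ` D \<union> rot ` rot ` D"
    and disj: "D \<inter> rot ` D = {}" "D \<inter> rot ` rot ` D = {}"
  shows "(f has_sum T / 3) D"
proof -
  have disj': "rot ` D \<inter> rot ` rot ` D = {}"
    using disj(1) inj_rot[of UNIV] by (metis image_Int image_empty)
  have "f summable_on D"
    using summable_on_subset[OF has_sum_imp_summable[OF f]] U by auto
  then obtain S where S: "(f has_sum S) D" by (auto simp: summable_on_def)
  have step: "(f has_sum S) (rot ` E)" if "(f has_sum S) E" for E
    using that by (subst has_sum_reindex[OF inj_rot]) (simp add: o_def inv)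
  have "(f has_sum S + S + S) U"
    unfolding U using disj disj'
    by (intro has_sum_Un_disjoint S step) auto
  with f have "T = S + S + S" by (rule has_sum_unique)
  with S show ?thesis by simp
qed

section \<open>Three-cores as lattice points\<close>

text \<open>The first-column hook lengths of a partition.\<close>

fun beta_list :: "nat list \<Rightarrow> nat list" where
  "beta_list [] = []"
| "beta_list (a # p) = (a + length p) # beta_list p"

fun unbeta_list :: "nat list \<Rightarrow> nat list" where
  "unbeta_list [] = []"
| "unbeta_list (b # l) = (b - length l) # unbeta_list l"

lemma length_beta [simp]: "length (beta_list p) = length p"
  by (induction p) auto

lemma length_unbeta [simp]: "length (unbeta_list l) = length l"
  by (induction l) auto

lemma unbeta_beta: "unbeta_list (beta_list p) = p"
  by (induction p) auto

lemma is_partition_Cons: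
  "is_partition (a # p) \<longleftrightarrow> is_partition p \<and> 0 < a \<and> (\<forall>x\<in>set p. x \<le> a)"
  by (auto simp: is_partition_def)

lemma beta_less:
  assumes "is_partition p" "\<forall>x\<in>set p. x \<le> a" "y \<in> set (beta_list p)"
  shows "y < a + length p"
  using assms
proof (induction p arbitrary: a)
  case (Cons c p)
  then have "y = c + length p \<or> y < c + length p" by (auto simp: is_partition_Cons)
  then show ?case using Cons.prems by auto
qed simp

lemma beta_strictly_decreasing:
  "is_partition p \<Longrightarrow> sorted_wrt (>) (beta_list p)"
  by (induction p) (auto simp: is_partition_Cons intro: beta_less)

lemma sorted_rev_beta: "is_partition p \<Longrightarrow> sorted_wrt (<) (rev (beta_list p))"
  using beta_strictly_decreasing by (simp add: sorted_wrt_rev)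

lemma beta_pos:
  "is_partition p \<Longrightarrow> 0 \<notin> set (beta_list p)"
  by (induction p) (auto simp: is_partition_Cons)

lemma decreasing_head_ge:
  assumes "sorted_wrt (>) (b # l)" "0 \<notin> set (b # l)"
  shows "length l < (b :: nat)"
  using assms
proof (induction l arbitrary: b)
  case (Cons c l)
  then have "length l < c" "c < b" by auto
  then show ?case by simp
qed simp

lemma beta_unbeta:
  "sorted_wrt (>) l \<Longrightarrow> 0 \<notin> set l \<Longrightarrow> beta_list (unbeta_list l) = l"
proof (induction l)
  case (Cons b l)
  then show ?case using decreasing_head_ge[of b l] by simp
qed simp

lemma is_partition_unbeta:
  "sorted_wrt (>) l \<Longrightarrow> 0 \<notin> set l \<Longrightarrow> is_partition (unbeta_list l)"
proof (induction l)
  case Nil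
  then show ?case by (simp add: is_partition_def)
next
  case (Cons b l)
  then have p: "is_partition (unbeta_list l)" by simp
  have "x \<le> b - length l" if "x \<in> set (unbeta_list l)" for x
  proof (cases l)
    case Nil
    then show ?thesis using that by simp
  next
    case (Cons c l')
    then have "x \<le> c - length l'" using p that by (auto simp: is_partition_Cons)
    moreover have "c < b" using Cons \<open>sorted_wrt (>) (b # l)\<close> by simp
    ultimately show ?thesis using Cons by simp
  qed
  then show ?case using p decreasing_head_ge[OF Cons.prems] by (simp add: is_partition_Cons)
qed

lemma sum_list_beta:
  "2 * sum_list (beta_list p) + length p = 2 * sum_list p + (length p)\<^sup>2"
  by (induction p) (auto simp: power2_eq_square)

lemma young_diagram_Cons:
  "young_diagram (a # p) = {0} \<times> {..<a} \<union> (\<lambda>(i, j). (Suc i, j)) ` young_diagram p"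
proof (intro set_eqI)
  fix c :: "nat \<times> nat"
  obtain i j where "c = (i, j)" by (cases c)
  then show "c \<in> young_diagram (a # p) \<longleftrightarrow> c \<in> {0} \<times> {..<a} \<union> (\<lambda>(i, j). (Suc i, j)) ` young_diagram p"
    by (cases i) (auto simp: young_diagram_def)
qed

lemma hook_number_Suc: "hook_number (a # p) (Suc i) j = hook_number p i j"
proof -
  have "hook (a # p) (Suc i) j = (\<lambda>(i, j). (Suc i, j)) ` hook p i j"
    unfolding hook_def young_diagram_Cons by auto
  moreover have "inj_on (\<lambda>(i, j :: nat). (Suc i, j)) (hook p i j)"
    by (auto simp: inj_on_def)
  ultimately show ?thesis by (simp add: hook_number_def card_image)
qed

text \<open>This is the leg length of column \<open>j\<close> below a new first row.\<close>

definition rows_longer :: "nat list \<Rightarrow> nat \<Rightarrow> nat" where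
  "rows_longer p j = length (filter (\<lambda>x. j < x) p)"

lemma hook_number_0:
  assumes "j < a"
  shows "hook_number (a # p) 0 j = a - j + rows_longer p j"
proof -
  have h: "hook (a # p) 0 j = {0} \<times> {j..<a} \<union> (\<lambda>i. (Suc i, j)) ` {i. i < length p \<and> j < p ! i}"
    unfolding hook_def young_diagram_Cons using assms by (auto simp: young_diagram_def)
  have "card (hook (a # p) 0 j) = card ({0 :: nat} \<times> {j..<a}) + card ((\<lambda>i. (Suc i, j)) ` {i. i < length p \<and> j < p ! i})"
    unfolding h by (rule card_Un_disjoint) auto
  also have "card ((\<lambda>i. (Suc i, j)) ` {i. i < length p \<and> j < p ! i}) = rows_longer p j"
    by (subst card_image) (auto simp: inj_on_def rows_longer_def length_filter_conv_card)
  finally show ?thesis by (simp add: hook_number_def)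
qed

text \<open>Deleting the first row does not change the hooks of the other rows, so only the hooks of the first row need
attention when a partition is built up row by row.\<close>

lemma is_core_Cons:
  "is_core t (a # p) \<longleftrightarrow> is_partition (a # p) \<and> is_core t p \<and> (\<forall>j<a. \<not> t dvd a - j + rows_longer p j)"
proof -
  have split: "(\<forall>(i, j)\<in>young_diagram (a # p). P i j) \<longleftrightarrow>
      (\<forall>j<a. P 0 j) \<and> (\<forall>(i, j)\<in>young_diagram p. P (Suc i) j)" for P
    unfolding young_diagram_Cons ball_Un by (auto simp: split_beta)
  show ?thesis
    unfolding is_core_def split by (auto simp: is_partition_Cons hook_number_Suc hook_number_0)
qed

text \<open>Walking along the rim of the diagram, rows are passed at the positions \<open>beta_list p\<close> and column
\<open>j\<close> at the position \<open>column_gap p j\<close>.\<close>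

definition column_gap :: "nat list \<Rightarrow> nat \<Rightarrow> nat" where
  "column_gap p j = j + length p - rows_longer p j"

lemma rows_longer_le: "rows_longer p j \<le> length p"
  by (simp add: rows_longer_def)

lemma column_gap_less: 
  assumes "j < k"
  shows "column_gap p j < column_gap p k"
proof -
  have "rows_longer p k \<le> rows_longer p j"
    unfolding rows_longer_def using assms by (induction p) auto
  then show ?thesis using assms rows_longer_le[of p j] rows_longer_le[of p k] by (simp add: column_gap_def)
qed

lemma column_gap_notin_beta:
  assumes "is_partition p"
  shows "column_gap p j \<notin> set (beta_list p)"
  using assms
proof (induction p)
  case (Cons c p)
  then have p: "is_partition p" "\<forall>x\<in>set p. x \<le> c" and IH: "column_gap p j \<notin> set (beta_list p)"
    by (auto simp: is_partition_Cons)
  show ?case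
  proof (cases "j < c")
    case True
    then have "column_gap (c # p) j = column_gap p j" by (simp add: column_gap_def rows_longer_def)
    moreover have "column_gap p j < c + length p" using True by (simp add: column_gap_def)
    ultimately show ?thesis using IH by simp
  next
    case False
    then have "rows_longer p j = 0" using p(2) by (force simp: rows_longer_def filter_empty_conv)
    then have "column_gap (c # p) j = j + length p + 1" using False by (simp add: column_gap_def rows_longer_def)
    then show ?thesis using False beta_less[OF p, of "column_gap (c # p) j"] by auto
  qed
qed simp

text \<open>One inclusion is \<open>column_gap_notin_beta\<close>; the other one comes for free, because both sides have
\<open>a\<close> elements.\<close>

lemma column_gap_image:
  assumes "is_partition p" "\<forall>x\<in>set p. x \<le> a"
  shows "column_gap p ` {..<a} = {..<a + length p} - set (beta_list p)"
proof (rule card_subset_eq)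
  show "column_gap p ` {..<a} \<subseteq> {..<a + length p} - set (beta_list p)"
  proof safe
    fix j assume "j < a"
    then show "column_gap p j < a + length p" by (auto simp: column_gap_def)
  qed (use column_gap_notin_beta[OF assms(1)] in auto)
  have "inj_on (column_gap p) {..<a}"
    by (rule inj_onI) (metis column_gap_less less_irrefl nat_neq_iff)
  then have "card (column_gap p ` {..<a}) = a"
    by (simp add: card_image)
  moreover have "card (set (beta_list p)) = length p"
    using sorted_rev_beta[OF assms(1)] by (subst distinct_card) (auto simp: strict_sorted_iff)
  moreover have "set (beta_list p) \<subseteq> {..<a + length p}" using beta_less[OF assms] by auto
  ultimately show "card (column_gap p ` {..<a}) = card ({..<a + length p} - set (beta_list p))"
    by (subst card_Diff_subset) auto
qed simp

text \<open>The hook lengths in a row are the differences between its beta number and the smaller numbers that are not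
beta numbers.\<close>

lemma is_core_iff_gaps:
  "is_core t p \<longleftrightarrow> is_partition p \<and>
    (\<forall>b\<in>set (beta_list p). \<forall>x<b. x \<notin> set (beta_list p) \<longrightarrow> \<not> t dvd b - x)"
proof (induction p)
  case Nil
  then show ?case by (simp add: is_core_Nil is_partition_def)
next
  case (Cons a p)
  show ?case
  proof (cases "is_partition (a # p)")
    case False
    then show ?thesis by (simp add: is_core_def)
  next
    case True
    then have p: "is_partition p" "\<forall>x\<in>set p. x \<le> a" by (auto simp: is_partition_Cons)
    have "a - j + rows_longer p j = a + length p - column_gap p j" if "j < a" for j
      using that rows_longer_le[of p j] by (simp add: column_gap_def)
    then have "(\<forall>j<a. \<not> t dvd a - j + rows_longer p j) \<longleftrightarrow> (\<forall>j\<in>{..<a}. \<not> t dvd a + length p - column_gap p j)"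
      by (simp add: Ball_def)
    also have "\<dots> \<longleftrightarrow> (\<forall>x\<in>column_gap p ` {..<a}. \<not> t dvd a + length p - x)"
      by simp
    also have "\<dots> \<longleftrightarrow> (\<forall>x<a + length p. x \<notin> set (beta_list p) \<longrightarrow> \<not> t dvd a + length p - x)"
      unfolding column_gap_image[OF p] by auto
    finally have row: "(\<forall>j<a. \<not> t dvd a - j + rows_longer p j) \<longleftrightarrow>
      (\<forall>x<a + length p. x \<notin> set (beta_list p) \<longrightarrow> \<not> t dvd a + length p - x)" .
    show ?thesis
      unfolding is_core_Cons row Cons.IH using True p beta_less[OF p]
      by (auto; metis less_trans nat_neq_iff)
  qed
qed

text \<open>If a beta number \<open>b\<close> and a smaller gap differ by a multiple of \<open>t\<close>, then going down
from \<open>b\<close> in steps of \<open>t\<close> meets a beta number whose next step lands on a gap.  So it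
suffices to exclude hooks of length \<open>t\<close>.\<close>

lemma is_core_iff_closed:
  assumes "0 < t"
  shows "is_core t p \<longleftrightarrow> is_partition p \<and> (\<forall>b\<in>set (beta_list p). t \<le> b \<longrightarrow> b - t \<in> set (beta_list p))"
proof -
  have "(\<forall>b\<in>B. \<forall>x<b. x \<notin> B \<longrightarrow> \<not> t dvd b - x) \<longleftrightarrow> (\<forall>b\<in>B. t \<le> b \<longrightarrow> b - t \<in> B)" for B :: "nat set"
  proof (intro iffI ballI allI impI notI)
    fix b assume "\<forall>b\<in>B. \<forall>x<b. x \<notin> B \<longrightarrow> \<not> t dvd b - x" "b \<in> B" "t \<le> b"
    then show "b - t \<in> B" using assms by (metis diff_diff_cancel diff_less dvd_refl less_le_trans)
  next
    fix b x assume closed: "\<forall>b\<in>B. t \<le> b \<longrightarrow> b - t \<in> B" and b: "b \<in> B" "x < b" "x \<notin> B" "t dvd b - x"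
    then obtain k where k: "b - x = t * k" by (elim dvdE)
    have "b - t * m \<in> B" if "m \<le> k" for m
      using that
    proof (induction m)
      case (Suc m)
      have "t * Suc m \<le> b" using k mult_le_mono2[OF Suc.prems, of t] by linarith
      then have "t \<le> b - t * m" by simp
      moreover have "b - t * m \<in> B" using Suc by simp
      ultimately have "b - t * m - t \<in> B" using closed by blast
      then show ?case by (simp add: diff_diff_left add.commute)
    qed (use b in simp)
    moreover have "b - t * k = x" using k b by linarith
    ultimately show False using b by force
  qed
  then show ?thesis unfolding is_core_iff_gaps by simp
qed

text \<open>Abacus positions occupied by the 3-core with \<open>a\<close> beads on runner 1 and \<open>b\<close> beads on
runner 2.  Runner 0 is empty because the last row of a partition is nonempty, so that 0 is not a beta number.\<close>

definition runners :: "nat \<Rightarrow> nat \<Rightarrow> nat set" where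
  "runners a b = (\<lambda>t. 3 * t + 1) ` {..<a} \<union> (\<lambda>t. 3 * t + 2) ` {..<b}"

lemma finite_down_closed:
  assumes "finite T" "\<And>t. Suc t \<in> T \<Longrightarrow> t \<in> T"
  shows "T = {..<card T}"
proof -
  have down: "s \<in> T" if "s \<le> t" "t \<in> T" for s t
    using that by (induction rule: inc_induct) (auto intro: assms(2))
  have "{..t} \<subseteq> T" if "t \<in> T" for t using down that by auto
  then have "card {..t} \<le> card T" if "t \<in> T" for t
    using that assms(1) by (intro card_mono) auto
  then have "T \<subseteq> {..<card T}" by (auto simp: Suc_le_eq)
  then show ?thesis by (intro card_subset_eq) auto
qed

lemma closed_eq_runners:
  assumes B: "finite B" "0 \<notin> B" "\<And>b. b \<in> B \<Longrightarrow> 3 \<le> b \<Longrightarrow> b - 3 \<in> B"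
  shows "B = runners (card {t. 3 * t + 1 \<in> B}) (card {t. 3 * t + 2 \<in> B})"
proof -
  have T: "{t. 3 * t + r \<in> B} = {..<card {t. 3 * t + r \<in> B}}" for r
  proof (rule finite_down_closed)
    have "finite ((\<lambda>t. 3 * t + r) ` {t. 3 * t + r \<in> B})"
      by (rule finite_subset[OF _ B(1)]) auto
    then show "finite {t. 3 * t + r \<in> B}"
      by (rule finite_imageD) (simp add: inj_on_def)
    show "t \<in> {t. 3 * t + r \<in> B}" if "Suc t \<in> {t. 3 * t + r \<in> B}" for t
      using B(3)[of "3 * Suc t + r"] that by simp
  qed
  have no0: "3 * t \<notin> B" for t
  proof (induction t)
    case (Suc t)
    then show ?case using B(3)[of "3 * Suc t"] by auto
  qed (use B(2) in simp)
  show ?thesis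
  proof (intro set_eqI iffI)
    fix x assume x: "x \<in> B"
    define t where "t = x div 3"
    have "x = 3 * t \<or> x = 3 * t + 1 \<or> x = 3 * t + 2" unfolding t_def by presburger
    then have "x = 3 * t + 1 \<and> t \<in> {t. 3 * t + 1 \<in> B} \<or> x = 3 * t + 2 \<and> t \<in> {t. 3 * t + 2 \<in> B}"
      using x no0[of t] by auto
    then show "x \<in> runners (card {t. 3 * t + 1 \<in> B}) (card {t. 3 * t + 2 \<in> B})"
      unfolding runners_def T[of 1, symmetric] T[of 2, symmetric] by blast
  next
    fix x assume "x \<in> runners (card {t. 3 * t + 1 \<in> B}) (card {t. 3 * t + 2 \<in> B})"
    then show "x \<in> B" unfolding runners_def T[of 1, symmetric] T[of 2, symmetric] by auto
  qed
qed

lemma runners_residues: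
  "{t. 3 * t + 1 \<in> runners a b} = {..<a}" "{t. 3 * t + 2 \<in> runners a b} = {..<b}"
  by (auto simp: runners_def; presburger)+

lemma sum_runners: "2 * int (\<Sum>(runners a b)) = 3 * int a ^ 2 - int a + 3 * int b ^ 2 + int b"
  and card_runners: "card (runners a b) = a + b"
proof -
  have inj: "inj_on (\<lambda>t. 3 * t + r) A" for r and A :: "nat set" by (auto simp: inj_on_def)
  have disj: "(\<lambda>t. 3 * t + 1) ` {..<a} \<inter> (\<lambda>t. 3 * t + 2) ` {..<b} = {}"
    by (auto; presburger)
  show "card (runners a b) = a + b"
    unfolding runners_def by (subst card_Un_disjoint) (simp_all only: disj card_image[OF inj], simp_all)
  have 1: "2 * int (\<Sum>t<n. 3 * t + 1) = 3 * int n ^ 2 - int n" for n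
    by (induction n) (simp_all add: power2_eq_square algebra_simps)
  have 2: "2 * int (\<Sum>t<n. 3 * t + 2) = 3 * int n ^ 2 + int n" for n
    by (induction n) (simp_all add: power2_eq_square algebra_simps)
  have "\<Sum>(runners a b) = (\<Sum>t<a. 3 * t + 1) + (\<Sum>t<b. 3 * t + 2)"
    unfolding runners_def by (subst sum.union_disjoint) (simp_all only: disj sum.reindex[OF inj], simp_all)
  then show "2 * int (\<Sum>(runners a b)) = 3 * int a ^ 2 - int a + 3 * int b ^ 2 + int b"
    using 1[of a] 2[of b] by simp
qed

definition core_of :: "nat \<times> nat \<Rightarrow> nat list" where
  "core_of = (\<lambda>(a, b). unbeta_list (rev (sorted_list_of_set (runners a b))))"

definition runner_lengths :: "nat list \<Rightarrow> nat \<times> nat" where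
  "runner_lengths p = (card {t. 3 * t + 1 \<in> set (beta_list p)}, card {t. 3 * t + 2 \<in> set (beta_list p)})"

lemma finite_runners: "finite (runners a b)"
  by (simp add: runners_def)

lemma beta_core_of: "beta_list (core_of (a, b)) = rev (sorted_list_of_set (runners a b))"
  and is_core_core_of: "is_core 3 (core_of (a, b))"
proof -
  have 1: "sorted_wrt (>) (rev (sorted_list_of_set (runners a b)))"
    using strict_sorted_list_of_set[of "runners a b"] by (simp add: sorted_wrt_rev)
  have 2: "0 \<notin> set (rev (sorted_list_of_set (runners a b)))"
    using finite_runners by (auto simp: runners_def)
  show b: "beta_list (core_of (a, b)) = rev (sorted_list_of_set (runners a b))"
    unfolding core_of_def by (simp add: beta_unbeta[OF 1 2])
  have "is_partition (core_of (a, b))"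
    unfolding core_of_def by (simp add: is_partition_unbeta[OF 1 2])
  moreover have "x - 3 \<in> runners a b" if x: "x \<in> runners a b" "3 \<le> x" for x
  proof -
    from x(1) consider t where "x = 3 * t + 1" "t < a" | t where "x = 3 * t + 2" "t < b"
      unfolding runners_def by blast
    then show ?thesis
    proof cases
      case (1 t)
      then have "x - 3 = 3 * (t - 1) + 1" "t - 1 \<in> {..<a}" using x(2) by auto
      then show ?thesis unfolding runners_def by blast
    next
      case (2 t)
      then have "x - 3 = 3 * (t - 1) + 2" "t - 1 \<in> {..<b}" using x(2) by auto
      then show ?thesis unfolding runners_def by blast
    qed
  qed
  ultimately show "is_core 3 (core_of (a, b))"
    by (simp add: is_core_iff_closed b finite_runners)
qed

lemma size_core_of: "3 * int (sum_list (core_of (a, b))) + 1 = hex_form (int a, int b)"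
proof -
  have "length (core_of (a, b)) = a + b"
    using arg_cong[OF beta_core_of[of a b], of length] by (simp add: card_runners)
  moreover have "sum_list (beta_list (core_of (a, b))) = \<Sum>(runners a b)"
    using sum_list_distinct_conv_sum_set[of "sorted_list_of_set (runners a b)" "\<lambda>x. x"]
    unfolding beta_core_of by (simp add: sum_list_rev finite_runners)
  ultimately have "2 * \<Sum>(runners a b) + (a + b) = 2 * sum_list (core_of (a, b)) + (a + b)\<^sup>2"
    using sum_list_beta[of "core_of (a, b)"] by simp
  then have "int (2 * \<Sum>(runners a b) + (a + b)) = int (2 * sum_list (core_of (a, b)) + (a + b)\<^sup>2)"
    by (rule arg_cong)
  then have "2 * int (\<Sum>(runners a b)) + (int a + int b) =
      2 * int (sum_list (core_of (a, b))) + (int a + int b)\<^sup>2"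
    by (simp only: of_nat_add of_nat_mult of_nat_numeral of_nat_power)
  then show ?thesis unfolding sum_runners by (simp add: hex_form_def power2_eq_square algebra_simps)
qed

lemma runner_lengths_core_of: "runner_lengths (core_of (a, b)) = (a, b)"
  by (simp add: runner_lengths_def beta_core_of finite_runners runners_residues[simplified])

lemma core_of_runner_lengths:
  assumes "is_core 3 p"
  shows "core_of (runner_lengths p) = p"
proof -
  have p: "is_partition p" "\<And>b. b \<in> set (beta_list p) \<Longrightarrow> 3 \<le> b \<Longrightarrow> b - 3 \<in> set (beta_list p)"
    using assms by (auto simp: is_core_iff_closed)
  have "sorted_list_of_set (set (beta_list p)) = rev (beta_list p)"
    using sorted_rev_beta[OF p(1)] sorted_list_of_set.idem_if_sorted_distinct[of "rev (beta_list p)"]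
    by (simp add: strict_sorted_iff)
  moreover have "set (beta_list p) = runners (card {t. 3 * t + 1 \<in> set (beta_list p)}) (card {t. 3 * t + 2 \<in> set (beta_list p)})"
    by (rule closed_eq_runners) (use p beta_pos in auto)
  ultimately show ?thesis by (simp add: core_of_def runner_lengths_def unbeta_beta)
qed

text \<open>The core with bead numbers \<open>(a, b)\<close> contributes \<open>g\<close> to the power
\<open>hex_form (a, b)\<close>, so the sum over cores is the sum over the quadrant
\<open>a, b \<ge> 0\<close>, which is a fundamental domain of \<^const>\<open>rot\<close>.\<close>

lemma has_sum_cores:
  assumes g: "\<bar>g\<bar> < 1"
  shows "((\<lambda>p. g powi (3 * int (sum_list p) + 1)) has_sum hex_series g / 3) {p. is_core 3 p}"
proof -
  define D :: "(int \<times> int) set" where "D = {(a, b). 0 \<le> a \<and> 0 \<le> b}"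
  \<comment> \<open>The quadrant and its two images are the three sectors of 120 degrees around the centre.\<close>
  have r1: "rot ` D = {(a, b). a < 0 \<and> a \<le> b}"
    unfolding rot_image D_def by (auto simp: rot_def)
  have r2: "rot ` {(a, b). a < 0 \<and> a \<le> b} = {(a, b). b < 0 \<and> b < a}"
    unfolding rot_image by (auto simp: rot_def)
  have "((\<lambda>v. g powi hex_form v) has_sum hex_series g / 3) D"
    by (rule has_sum_rot_fundamental_domain[OF has_sum_hex_series[OF g]]; (simp only: hex_form_rot r1 r2)?) (auto simp: D_def)
  also have "?this \<longleftrightarrow> ((\<lambda>v. g powi hex_form v) has_sum hex_series g / 3) (map_prod int int ` UNIV)"
  proof -
    have "D = map_prod int int ` UNIV"
      by (auto simp: D_def image_iff intro!: exI[of _ "nat _"])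
    then show ?thesis by simp
  qed
  also have "\<dots> \<longleftrightarrow> ((\<lambda>v. g powi hex_form (map_prod int int v)) has_sum hex_series g / 3) UNIV"
    by (subst has_sum_reindex) (auto simp: inj_on_def o_def)
  also have "\<dots> \<longleftrightarrow> ((\<lambda>p. g powi (3 * int (sum_list p) + 1)) has_sum hex_series g / 3) {p. is_core 3 p}"
    by (rule has_sum_reindex_bij_witness[where j = core_of and i = runner_lengths])
       (auto simp: runner_lengths_core_of core_of_runner_lengths is_core_core_of size_core_of)
  finally show ?thesis .
qed

section \<open>Identities between theta series from changes of lattice\<close>

text \<open>Three numbers congruent to 1, 3 and -1 modulo 6 have an odd sum divisible by three.  Splitting the vector into
its mean \<open>w\<close> and its component of sum zero decomposes the sum of squares as
\<open>3 * w\<^sup>2 + 8 * hex_form (a, b)\<close>.  The residue of \<open>w\<close> fixes the class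
of \<open>a + b\<close> modulo 3, but each class is a fundamental domain of \<^const>\<open>rot\<close> and
carries a third of the series.\<close>

lemma theta_triple_eq_theta_hex_series:
  assumes s: "0 < s" "s < 1"
  shows "3 * (theta 6 1 s)\<^sup>2 * theta 6 3 s = theta 2 1 (s powi 3) * hex_series (s powi 8)"
proof -
  have s3: "0 < s powi 3" "s powi 3 < 1" and s8: "\<bar>s powi 8\<bar> < 1"
    using s by (auto simp: power_less_one_iff)
  \<comment> \<open>The class of \<open>a + b\<close> modulo 3; the rotation moves it to the next class.\<close>
  define S where "S = (\<lambda>m::int. {(a, b). 3 dvd m - a - b} :: (int \<times> int) set)"
  have third: "((\<lambda>v. (s powi 8) powi hex_form v) has_sum hex_series (s powi 8) / 3) (S m)" for m
  proof (rule has_sum_rot_fundamental_domain)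
    show "((\<lambda>v. (s powi 8) powi hex_form v) has_sum hex_series (s powi 8)) UNIV"
      using s8 by (rule has_sum_hex_series)
    have rotS: "rot ` S m = S (m + 1)" for m
      unfolding rot_image S_def by (simp add: set_eq_iff rot_def) presburger
    show "UNIV = S m \<union> rot ` S m \<union> rot ` rot ` S m"
      unfolding rotS unfolding S_def by (auto; presburger)
    show "S m \<inter> rot ` S m = {}" "S m \<inter> rot ` rot ` S m = {}"
      unfolding rotS unfolding S_def by (auto; presburger)+
  qed (simp add: hex_form_rot)
  define F where "F = (\<lambda>(m::int, v). (s powi 3) powi ((2 * m + 1)\<^sup>2) * (s powi 8) powi hex_form v)"
  have w: "((\<lambda>m. (s powi 3) powi ((2 * m + 1)\<^sup>2)) has_sum theta 2 1 (s powi 3)) UNIV"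
    by (rule has_sum_theta[OF s3]) simp
  have "F summable_on UNIV \<times> UNIV"
    unfolding F_def by (rule has_sum_imp_summable[OF has_sum_times[OF w has_sum_hex_series[OF s8]]])
  then have sumF: "F summable_on Sigma UNIV S"
    by (rule summable_on_subset) auto
  have "(F has_sum theta 2 1 (s powi 3) * (hex_series (s powi 8) / 3)) (Sigma UNIV S)"
  proof (rule has_sum_SigmaI[OF _ _ sumF])
    show "((\<lambda>v. F (m, v)) has_sum (s powi 3) powi ((2 * m + 1)\<^sup>2) * (hex_series (s powi 8) / 3)) (S m)" for m
      using has_sum_cmult_right[OF third] by (simp add: F_def)
    show "((\<lambda>m. (s powi 3) powi ((2 * m + 1)\<^sup>2) * (hex_series (s powi 8) / 3)) has_sum
        theta 2 1 (s powi 3) * (hex_series (s powi 8) / 3)) UNIV"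
      by (rule has_sum_cmult_left[OF w])
  qed
  moreover have "(F has_sum theta 6 1 s * (theta 6 3 s * theta 6 1 s)) (Sigma UNIV S)"
  proof -
    have "((\<lambda>(i, j, k). s powi ((6 * i + 1)\<^sup>2) * (s powi ((6 * j + 3)\<^sup>2) * s powi ((6 * k + - 1)\<^sup>2)))
        has_sum theta 6 1 s * (theta 6 3 s * theta 6 (- 1) s)) (UNIV \<times> UNIV \<times> UNIV)"
      using has_sum_times[OF has_sum_theta[OF s, of 6 1] has_sum_times[OF
          has_sum_theta[OF s, of 6 3] has_sum_theta[OF s, of 6 "- 1"]]]
      by (simp add: case_prod_unfold)
    also have "?this \<longleftrightarrow> (F has_sum theta 6 1 s * (theta 6 3 s * theta 6 (- 1) s)) (Sigma UNIV S)"
    \<comment> \<open>The mean of the triple \<open>6 * i + 1\<close>, \<open>6 * j + 3\<close>, \<open>6 * k - 1\<close> is \<open>2 * m + 1\<close> with \<open>m = i + j + k\<close>.\<close>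
    proof (rule has_sum_reindex_bij_witness[where j = "\<lambda>(i, j, k). (i + j + k, i - k, j - k)"
          and i = "\<lambda>(m, a, b). (a + (m - a - b) div 3, b + (m - a - b) div 3, (m - a - b) div 3)"],
        goal_cases)
      case (5 v)
      obtain i j k where v: "v = (i, j, k)" by (cases v)
      have e: "3 * (2 * (i + j + k) + 1)\<^sup>2 + 8 * hex_form (i - k, j - k)
          = (6 * i + 1)\<^sup>2 + ((6 * j + 3)\<^sup>2 + (6 * k + - 1)\<^sup>2)"
        by (simp add: hex_form_def power2_eq_square algebra_simps)
      have "F (i + j + k, i - k, j - k) = s powi (3 * (2 * (i + j + k) + 1)\<^sup>2 + 8 * hex_form (i - k, j - k))"
        using s by (simp add: F_def power_int_add power_int_mult del: power_int_numeral)
      also have "\<dots> = s powi ((6 * i + 1)\<^sup>2) * (s powi ((6 * j + 3)\<^sup>2) * s powi ((6 * k + - 1)\<^sup>2))"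
        using s unfolding e by (simp add: power_int_add)
      finally show ?case by (simp add: v)
    qed (auto simp: S_def elim!: dvdE)
    finally show ?thesis by (simp add: theta_uminus)
  qed
  ultimately have "theta 2 1 (s powi 3) * (hex_series (s powi 8) / 3) = theta 6 1 s * (theta 6 3 s * theta 6 1 s)"
    by (rule has_sum_unique)
  then show ?thesis by (simp add: power2_eq_square algebra_simps)
qed

text \<open>An element of the Eisenstein integers with even norm is divisible by the inert prime 2, so the terms with even
exponent form a copy of the series at \<open>g ^ 4\<close>.\<close>

lemma has_sum_hex_series_odd:
  assumes g: "\<bar>g\<bar> < 1"
  shows "((\<lambda>v. g powi hex_form v) has_sum hex_series g - hex_series (g ^ 4)) {v. odd (hex_form v)}"
proof -
  have g4: "\<bar>g ^ 4\<bar> < 1" using power_strict_mono[of "\<bar>g\<bar>" 1 4] g by (simp add: power_abs)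
  have parity: "even (hex_form (a, b)) \<longleftrightarrow> odd a \<and> even b" for a b
    by (cases "even a"; cases "even b") (simp_all add: hex_form_def)
  have "((\<lambda>v. g powi hex_form v) has_sum hex_series (g ^ 4)) {v. even (hex_form v)}"
  proof -
    have "((\<lambda>v. (g ^ 4) powi hex_form v) has_sum hex_series (g ^ 4)) UNIV"
      using g4 by (rule has_sum_hex_series)
    also have "?this \<longleftrightarrow> ((\<lambda>v. g powi hex_form v) has_sum hex_series (g ^ 4)) {v. even (hex_form v)}"
    \<comment> \<open>The dilation by -2 about the centre \<open>(- 1 / 3, - 2 / 3)\<close>; the factor 2 would not preserve the lattice.\<close>
    proof (rule has_sum_reindex_bij_witness[where j = "\<lambda>(a, b). (- 2 * a - 1, - 2 * b - 2)"
          and i = "\<lambda>(a, b). (- ((a + 1) div 2), - ((b + 2) div 2))"], goal_cases)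
      case (5 v)
      obtain a b where v: "v = (a, b)" by (cases v)
      have e: "hex_form (- 2 * a - 1, - 2 * b - 2) = 4 * hex_form v"
        by (simp add: v hex_form_def power2_eq_square algebra_simps)
      have "g powi (4 * hex_form v) = (g powi 4) powi hex_form v" by (rule power_int_mult)
      then show ?case using e by (simp add: v)
    qed (auto simp: parity elim!: oddE)
    finally show ?thesis .
  qed
  then have "((\<lambda>v. g powi hex_form v) has_sum hex_series g - hex_series (g ^ 4)) (UNIV - {v. even (hex_form v)})"
    by (intro has_sum_Diff has_sum_hex_series g) auto
  moreover have "UNIV - {v. even (hex_form v)} = {v. odd (hex_form v)}" by auto
  ultimately show ?thesis by simp
qed

lemma hex_series_uminus:
  assumes g: "\<bar>g\<bar> < 1"
  shows "hex_series (- g) = 2 * hex_series (g ^ 4) - hex_series g"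
proof -
  have "((\<lambda>v. (- g) powi hex_form v) has_sum hex_series (- g) - hex_series (g ^ 4)) {v. odd (hex_form v)}"
    using has_sum_hex_series_odd[of "- g"] g by simp
  moreover have "((\<lambda>v. (- g) powi hex_form v) has_sum - (hex_series g - hex_series (g ^ 4))) {v. odd (hex_form v)}"
    using has_sum_uminusI[OF has_sum_hex_series_odd[OF g]] 
    by (rule has_sum_cong[THEN iffD1, rotated]) (auto simp: power_int_minus_left)
  ultimately have "hex_series (- g) - hex_series (g ^ 4) = - (hex_series g - hex_series (g ^ 4))" by (rule has_sum_unique)
  then show ?thesis by simp
qed

text \<open>Four times the norm of an Eisenstein integer is \<open>3 * w\<^sup>2 + w'\<^sup>2\<close>, where
\<open>w\<close> is any one of the three coordinates of sum zero.  If the norm is odd, exactly two of these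
coordinates are odd.  The pairs of odd numbers on the left enumerate the points at which one chosen coordinate
is odd, and by symmetry this is two thirds of the sum over odd norms. The chosen coordinate is
\<open>2 * b - a + 1\<close>, which is odd when \<open>a\<close> is even.\<close>

lemma theta_pair_eq_odd_hex_series:
  assumes s: "0 < s" "s < 1"
  shows "3 * (theta 2 1 (s powi 3) * theta 6 1 s) = 2 * (hex_series (s ^ 4) - hex_series (s ^ 16))"
proof -
  have s3: "0 < s powi 3" "s powi 3 < 1" and s4: "\<bar>s ^ 4\<bar> < 1"
    using s by (auto simp: power_less_one_iff)
  define T where "T = hex_series (s ^ 4) - hex_series (s ^ 16)"
  define f where "f = (\<lambda>v. (s ^ 4) powi hex_form v)"
  have T: "(f has_sum T) {v. odd (hex_form v)}"
    using has_sum_hex_series_odd[OF s4] by (simp add: T_def f_def flip: power_mult)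
  \<comment> \<open>The three classes are cyclically permuted by the rotation; the fourth class, with \<open>a\<close> odd and \<open>b\<close> even, consists of the points of even norm.\<close>
  define D where "D = {(a, b). even (a :: int) \<and> even (b :: int)}"
  define D' where "D' = {(a, b). even (a :: int) \<and> odd (b :: int)}"
  define H where "H = {(a, b). odd (a :: int) \<and> odd (b :: int)}"
  have rotD: "rot ` D = H" "rot ` H = D'" "rot ` D' = D"
    unfolding rot_image by (auto simp: rot_def D_def D'_def H_def)
  have inv: "f (rot v) = f v" for v by (simp add: f_def hex_form_rot)
  have "(f has_sum T / 3) D"
    by (rule has_sum_rot_fundamental_domain[OF T inv]; unfold rotD) (auto simp: D_def D'_def H_def hex_form_def)
  moreover have "(f has_sum T / 3) D'"
    by (rule has_sum_rot_fundamental_domain[OF T inv]; unfold rotD) (auto simp: D_def D'_def H_def hex_form_def)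
  ultimately have "(f has_sum T / 3 + T / 3) (D \<union> D')"
    by (rule has_sum_Un_disjoint) (auto simp: D_def D'_def)
  moreover have "D \<union> D' = {(a, b). even a}" by (auto simp: D_def D'_def)
  moreover have "(f has_sum theta 2 1 (s powi 3) * theta 6 1 s) {(a, b). even a}"
  proof -
    have "((\<lambda>(i, j). (s powi 3) powi ((2 * i + 1)\<^sup>2) * s powi ((6 * j + 1)\<^sup>2)) has_sum
        theta 2 1 (s powi 3) * theta 6 1 s) (UNIV \<times> UNIV)"
      by (intro has_sum_times has_sum_theta s s3) auto
    also have "?this \<longleftrightarrow> (f has_sum theta 2 1 (s powi 3) * theta 6 1 s) {(a, b). even a}"
    proof (rule has_sum_reindex_bij_witness[where j = "\<lambda>(i, j). (2 * j, i + j)"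
          and i = "\<lambda>(a, b). (b - a div 2, a div 2)"], goal_cases)
      case (5 v)
      obtain i j where v: "v = (i, j)" by (cases v)
      have e: "4 * hex_form (2 * j, i + j) = 3 * (2 * i + 1)\<^sup>2 + (6 * j + 1)\<^sup>2"
        by (simp add: hex_form_def power2_eq_square algebra_simps)
      have "f (2 * j, i + j) = s powi (4 * hex_form (2 * j, i + j))"
        by (simp add: f_def power_int_mult)
      also have "\<dots> = s powi (3 * (2 * i + 1)\<^sup>2) * s powi ((6 * j + 1)\<^sup>2)"
        using s unfolding e by (simp add: power_int_add)
      finally show ?case by (simp add: v power_int_mult)
    qed auto
    finally show ?thesis .
  qed
  ultimately have "theta 2 1 (s powi 3) * theta 6 1 s = T / 3 + T / 3"
    by (metis has_sum_unique)
  then show ?thesis by (simp add: T_def)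
qed

text \<open>Right multiplication by a quaternion of norm 3 maps the quadruples of odd numbers onto those odd quadruples
whose reduction modulo 3 lies in a certain totally isotropic plane.  A nonzero vector of that plane has
exactly one coordinate divisible by 3.  The plane has nine vectors: the zero vector yields
\<open>theta 6 3 s ^ 4\<close>, and the other eight yield
\<open>theta 6 1 s ^ 3 * theta 6 3 s\<close> each.\<close>

lemma theta_odd_fourth_power:
  assumes s: "0 < s" "s < 1"
  shows "theta 2 1 (s powi 3) ^ 4 = 8 * theta 6 1 s ^ 3 * theta 6 3 s + theta 6 3 s ^ 4"
proof -
  have s3: "0 < s powi 3" "s powi 3 < 1"
    using s by (auto simp: power_less_one_iff)
  have th: "((\<lambda>i. s powi ((6 * i + r)\<^sup>2)) has_sum theta 6 r s) UNIV" for r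
    by (rule has_sum_theta[OF s]) simp
  \<comment> \<open>The image \<open>\<beta>\<close> of an odd quadruple is written as \<open>6 * p + (2 * u + 1)\<close>, \<open>6 * q + (2 * v + 1)\<close>, and so on; the residues of the last
    two entries modulo 6 are determined by \<open>u\<close> and \<open>v\<close> because \<open>\<beta>\<close> modulo 3 lies in the isotropic plane.\<close>
  define F :: "(int \<times> int) \<times> (int \<times> int) \<times> (int \<times> int) \<Rightarrow> real" where
    "F = (\<lambda>((u, v), (p, q), (r, t)). (s powi ((6 * p + (2 * u + 1))\<^sup>2) * s powi ((6 * q + (2 * v + 1))\<^sup>2)) *
        (s powi ((6 * r + (1 - 2 * u - 2 * v))\<^sup>2) * s powi ((6 * t + (2 * v - 2 * u + 3))\<^sup>2)))"
  define g where "g = (\<lambda>(u, v). theta 6 (2 * u + 1) s * theta 6 (2 * v + 1) s * (theta 6 (1 - 2 * u - 2 * v) s * theta 6 (2 * v - 2 * u + 3) s))"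
  define R where "R = {0, 1, 2 :: int}"
  define T where "T = theta 2 1 (s powi 3)"
  have "((\<lambda>i. (s powi 3) powi ((2 * i + 1)\<^sup>2)) has_sum T) UNIV"
    unfolding T_def by (rule has_sum_theta[OF s3]) simp
  note TT = has_sum_times[OF this this]
  have "((\<lambda>((i, j), (k, l)). ((s powi 3) powi ((2 * i + 1)\<^sup>2) * (s powi 3) powi ((2 * j + 1)\<^sup>2)) *
      ((s powi 3) powi ((2 * k + 1)\<^sup>2) * (s powi 3) powi ((2 * l + 1)\<^sup>2))) has_sum T * T * (T * T))
      ((UNIV \<times> UNIV) \<times> (UNIV \<times> UNIV))"
    using has_sum_times[OF TT TT] by (simp add: case_prod_unfold)
  also have "?this \<longleftrightarrow> (F has_sum T * T * (T * T)) (Sigma (R \<times> R) (\<lambda>_. (UNIV \<times> UNIV) \<times> (UNIV \<times> UNIV)))"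
  proof (rule has_sum_reindex_bij_witness[where
        j = "\<lambda>((i, j), (k, l)). let u = (i + j - l) mod 3; p = (i + j - l) div 3;
            v = (i - j + k) mod 3; q = (i - j + k) div 3 in ((u, v), (p, q), (i - p - q, j - p + q))"
        and i = "\<lambda>((u, v), (p, q), (r, t)). ((p + q + r, p - q + t), (q - r + t + v, r - p + t - u))"],
        goal_cases)
    case (1 a)
    obtain i j k l where a: "a = ((i, j), (k, l))" by (metis surj_pair)
    define u p where "u = (i + j - l) mod 3" and "p = (i + j - l) div 3"
    define v q where "v = (i - j + k) mod 3" and "q = (i - j + k) div 3"
    have "l = i + j - (3 * p + u)" and "k = j - i + (3 * q + v)"
      by (simp_all add: u_def p_def v_def q_def)
    then show ?case
      unfolding a Let_def prod.case u_def [symmetric] p_def [symmetric] v_def [symmetric] q_def [symmetric]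
      by simp
  next
    case (2 a)
    obtain i j k l where a: "a = ((i, j), (k, l))" by (metis surj_pair)
    show ?case by (simp add: a Let_def R_def) presburger
  next
    case (3 b)
    then show ?case by (auto simp: Let_def R_def)
  next
    case (5 a)
    obtain i j k l where a: "a = ((i, j), (k, l))" by (metis surj_pair)
    define u p where "u = (i + j - l) mod 3" and "p = (i + j - l) div 3"
    define v q where "v = (i - j + k) mod 3" and "q = (i - j + k) div 3"
    have l: "l = i + j - (3 * p + u)" and k: "k = j - i + (3 * q + v)"
      by (simp_all add: u_def p_def v_def q_def)
    \<comment> \<open>For \<open>a, b, c, d\<close> the odd numbers \<open>2 * i + 1\<close>, \<open>2 * j + 1\<close>, \<open>2 * k + 1\<close>, \<open>2 * l + 1\<close>, the four entries on the left are \<open>a + b - d\<close>, \<open>a - b + c\<close>, \<open>a - c + d\<close> and \<open>b + c + d\<close>.\<close>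
    have e: "((6 * p + (2 * u + 1))\<^sup>2 + (6 * q + (2 * v + 1))\<^sup>2) +
        ((6 * (i - p - q) + (1 - 2 * u - 2 * v))\<^sup>2 + (6 * (j - p + q) + (2 * v - 2 * u + 3))\<^sup>2) =
        3 * (((2 * i + 1)\<^sup>2 + (2 * j + 1)\<^sup>2) + ((2 * k + 1)\<^sup>2 + (2 * l + 1)\<^sup>2))"
      unfolding k l by (simp add: power2_eq_square algebra_simps)
    have "F ((u, v), (p, q), (i - p - q, j - p + q)) =
        s powi (3 * (((2 * i + 1)\<^sup>2 + (2 * j + 1)\<^sup>2) + ((2 * k + 1)\<^sup>2 + (2 * l + 1)\<^sup>2)))"
      using s unfolding e [symmetric] by (simp add: F_def power_int_add)
    also have "\<dots> = ((s powi 3) powi ((2 * i + 1)\<^sup>2) * (s powi 3) powi ((2 * j + 1)\<^sup>2)) *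
      ((s powi 3) powi ((2 * k + 1)\<^sup>2) * (s powi 3) powi ((2 * l + 1)\<^sup>2))"
      using s by (simp add: power_int_add power_int_mult distrib_left)
    finally show ?case by (simp add: a Let_def u_def v_def p_def q_def)
  qed auto
  finally have "(F has_sum T * T * (T * T)) (Sigma (R \<times> R) (\<lambda>_. (UNIV \<times> UNIV) \<times> (UNIV \<times> UNIV)))" .
  moreover have "((\<lambda>w. F (x, w)) has_sum g x) ((UNIV \<times> UNIV) \<times> (UNIV \<times> UNIV))" for x
  proof (cases x)
    case (Pair u v)
    show ?thesis
      using has_sum_times[OF has_sum_times[OF th[of "2 * u + 1"] th[of "2 * v + 1"]]
          has_sum_times[OF th[of "1 - 2 * u - 2 * v"] th[of "2 * v - 2 * u + 3"]]]
      by (simp add: Pair F_def g_def case_prod_unfold)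
  qed
  ultimately have "(g has_sum T * T * (T * T)) (R \<times> R)"
    by (rule has_sum_SigmaD)
  moreover have "(g has_sum sum g (R \<times> R)) (R \<times> R)"
    by (rule has_sum_finite) (simp add: R_def)
  ultimately have "T * T * (T * T) = sum g (R \<times> R)"
    by (rule has_sum_unique)
  moreover have "sum g (R \<times> R) = 8 * theta 6 1 s ^ 3 * theta 6 3 s + theta 6 3 s ^ 4"
  proof -
    have eqs: "theta 6 (- 7) s = theta 6 1 s" "theta 6 (- 5) s = theta 6 1 s"
      "theta 6 (- 3) s = theta 6 3 s" "theta 6 (- 1) s = theta 6 1 s"
      "theta 6 5 s = theta 6 1 s" "theta 6 7 s = theta 6 1 s"
      using theta_shift[of 6 1 s] theta_shift[of 6 "- 1" s] theta_uminus[of 6 7 s]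
        theta_uminus[of 6 5 s] theta_uminus[of 6 3 s] theta_uminus[of 6 1 s] by simp_all
    show ?thesis
      by (simp add: R_def g_def eqs sum.cartesian_product[symmetric] power_numeral_reduce)
  qed
  ultimately show ?thesis by (simp add: T_def power_numeral_reduce)
qed

section \<open>The Jacobi triple product\<close>

definition qfac :: "real \<Rightarrow> nat \<Rightarrow> real" where
  "qfac Q n = (\<Prod>j<n. 1 - Q ^ Suc j)"

text \<open>With the value 0 at negative arguments, the recurrence \<open>inv_qfac_pred\<close> holds for all integers,
and no boundary cases arise in the finite triple product.\<close>

definition inv_qfac :: "real \<Rightarrow> int \<Rightarrow> real" where
  "inv_qfac Q k = (if k < 0 then 0 else 1 / qfac Q (nat k))"

lemma qfac_pos:
  assumes "0 < Q" "Q < 1"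
  shows "0 < qfac Q n"
  unfolding qfac_def using assms by (intro prod_pos) (simp add: power_less_one_iff del: power_Suc)

lemma inv_qfac_pred:
  assumes "0 < Q" "Q < 1"
  shows "inv_qfac Q (k - 1) = (1 - Q powi k) * inv_qfac Q k"
proof (cases "k > 0")
  case True
  then obtain n where n: "k = int (Suc n)" by (metis gr0_implies_Suc zero_less_imp_eq_int of_nat_0_less_iff)
  have "qfac Q (Suc n) = qfac Q n * (1 - Q ^ Suc n)" by (simp add: qfac_def)
  moreover have "1 - Q ^ Suc n \<noteq> 0"
    using assms by (simp add: power_less_one_iff less_imp_neq del: power_Suc)
  moreover have "Q powi k = Q ^ Suc n" unfolding n by (rule power_int_of_nat)
  moreover have "nat k = Suc n" "nat (k - 1) = n" using n by auto
  ultimately show ?thesis using qfac_pos[OF assms, of n] qfac_pos[OF assms, of "Suc n"] True by (simp add: inv_qfac_def field_simps)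
qed (auto simp: inv_qfac_def)

text \<open>The Gaussian binomial coefficient of \<open>2 * n\<close> over \<open>n + k\<close>, which vanishes for
\<open>\<bar>k\<bar> > n\<close>.\<close>

definition central_qbinomial :: "real \<Rightarrow> nat \<Rightarrow> int \<Rightarrow> real" where
  "central_qbinomial Q n k = inv_qfac Q (int n - k) * inv_qfac Q (int n + k) / inv_qfac Q (2 * int n)"

text \<open>In terms of \<open>a\<close> and \<open>b\<close>, the powers of \<open>Q\<close> with exponents
\<open>n + 1 - k\<close> and \<open>n + 1 + k\<close>, the four coefficients are multiples of one
quantity, and the recurrence becomes a polynomial identity.\<close>

lemma central_qbinomial_Suc:
  assumes Q: "0 < Q" "Q < 1"
  shows "central_qbinomial Q (Suc n) k = (1 + Q powi (2 * int n + 1)) * central_qbinomial Q n k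
    + Q powi (int n + 1 - k) * central_qbinomial Q n (k - 1) + Q powi (int n + 1 + k) * central_qbinomial Q n (k + 1)"
proof -
  define u v w where "u = inv_qfac Q (int n + 1 - k)" and "v = inv_qfac Q (int n + 1 + k)"
    and "w = inv_qfac Q (2 * int n + 2)"
  define a b where "a = Q powi (int n + 1 - k)" and "b = Q powi (int n + 1 + k)"
  have ab: "Q powi (2 * int n + 2) = a * b" "Q powi (2 * int n + 1) = a * b / Q"
    "Q powi (int n - k) = a / Q" "Q powi (int n + k) = b / Q"
  proof -
    show *: "Q powi (2 * int n + 2) = a * b"
      using Q power_int_add[of Q "int n + 1 - k" "int n + 1 + k"] by (simp add: a_def b_def)
    have "Q powi (m - 1) = Q powi m / Q" for m using Q by (simp add: power_int_diff)
    from this[of "2 * int n + 2"] this[of "int n + 1 - k"] this[of "int n + 1 + k"]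
    show "Q powi (2 * int n + 1) = a * b / Q" "Q powi (int n - k) = a / Q" "Q powi (int n + k) = b / Q"
      unfolding * a_def [symmetric] b_def [symmetric] by (simp_all add: add.commute)
  qed
  have r1: "inv_qfac Q (int n - k) = (1 - a) * u" "inv_qfac Q (int n + k) = (1 - b) * v"
    using inv_qfac_pred[OF Q, of "int n + 1 - k"] inv_qfac_pred[OF Q, of "int n + 1 + k"]
    by (simp_all add: u_def v_def a_def b_def algebra_simps)
  have r2: "inv_qfac Q (int n - (k + 1)) = (1 - a / Q) * ((1 - a) * u)"
    "inv_qfac Q (int n + (k - 1)) = (1 - b / Q) * ((1 - b) * v)"
    using inv_qfac_pred[OF Q, of "int n - k"] inv_qfac_pred[OF Q, of "int n + k"]
    unfolding r1 ab by (simp_all only: diff_diff_eq add_diff_eq)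
  define c where "c = a * b / Q"
  define D where "D = inv_qfac Q (2 * int n)"
  have "inv_qfac Q (2 * int n + 1) = (1 - a * b) * w"
    using inv_qfac_pred[OF Q, of "2 * int n + 2"] unfolding ab w_def [symmetric] by (simp add: add.commute)
  then have D: "D = (1 - c) * ((1 - a * b) * w)"
    using inv_qfac_pred[OF Q, of "2 * int n + 1"] unfolding ab c_def [symmetric] by (simp add: D_def)
  have "D > 0" using qfac_pos[OF Q] by (simp add: inv_qfac_def D_def)
  then have nz: "1 - c \<noteq> 0" "1 - a * b \<noteq> 0" "w \<noteq> 0" unfolding D by auto
  have r3: "inv_qfac Q (int (Suc n) - k) = u" "inv_qfac Q (int (Suc n) + k) = v"
    "inv_qfac Q (2 * int (Suc n)) = w" "inv_qfac Q (int n - (k - 1)) = u" "inv_qfac Q (int n + (k + 1)) = v"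
    by (simp_all add: u_def v_def w_def algebra_simps)
  define X where "X = u * v / D"
  have "u * v / w = (1 - c) * (1 - a * b) * X"
    unfolding X_def D using nz by simp
  also have "(1 - c) * (1 - a * b) =
      (1 + c) * ((1 - a) * (1 - b)) + a * ((1 - b / Q) * (1 - b)) + b * ((1 - a / Q) * (1 - a))"
    using Q by (simp add: c_def field_simps)
  finally have "u * v / w = (1 + c) * ((1 - a) * (1 - b) * X)
      + a * ((1 - b / Q) * (1 - b) * X) + b * ((1 - a / Q) * (1 - a) * X)"
    by (simp only: distrib_right mult.assoc)
  moreover have "(1 - a) * u * ((1 - b) * v) / D = (1 - a) * (1 - b) * X"
    "u * ((1 - b / Q) * ((1 - b) * v)) / D = (1 - b / Q) * (1 - b) * X"
    "(1 - a / Q) * ((1 - a) * u) * v / D = (1 - a / Q) * (1 - a) * X"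
    by (simp_all add: X_def)
  ultimately show ?thesis
    unfolding central_qbinomial_def ab a_def [symmetric] b_def [symmetric] r1 r2 r3 D_def [symmetric] c_def [symmetric]
    by (simp only:)
qed

text \<open>Multiplying by the next two factors acts on the coefficients by the recurrence
\<open>central_qbinomial_Suc\<close>.\<close>

lemma finite_triple_product:
  assumes r: "0 < r" "r < 1" and z: "0 < z"
  shows "((\<lambda>k. central_qbinomial (r\<^sup>2) n k * (r powi (k\<^sup>2) * z powi k)) has_sum
    (\<Prod>j<n. (1 + z * r ^ (2 * j + 1)) * (1 + r ^ (2 * j + 1) / z))) UNIV"
proof (induction n)
  case 0
  show ?case
    by (rule has_sum_finite_neutralI[where B = "{0}"])
       (auto simp: central_qbinomial_def inv_qfac_def qfac_def)
next
  case (Suc n)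
  have Q: "0 < r\<^sup>2" "r\<^sup>2 < 1" using r by (auto simp: power_less_one_iff)
  define P where "P = (\<Prod>j<n. (1 + z * r ^ (2 * j + 1)) * (1 + r ^ (2 * j + 1) / z))"
  define f where "f k = central_qbinomial (r\<^sup>2) n k * (r powi (k\<^sup>2) * z powi k)" for k
  have f: "(f has_sum P) UNIV" unfolding f_def P_def by (rule Suc.IH)
  have f1: "((\<lambda>k. f (k - 1)) has_sum P) UNIV"
    using f by (subst has_sum_reindex_bij_witness[where i = "\<lambda>k. k + 1" and j = "\<lambda>k. k - 1" and T = UNIV]) auto
  have f2: "((\<lambda>k. f (k + 1)) has_sum P) UNIV"
    using f by (subst has_sum_reindex_bij_witness[where i = "\<lambda>k. k - 1" and j = "\<lambda>k. k + 1" and T = UNIV]) auto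
  define t where "t = r ^ (2 * n + 1)"
  have "int (2 * n + 1) = 2 * int n + 1" by simp
  then have tt: "t = r powi (2 * int n + 1)"
    using power_int_of_nat[of r "2 * n + 1"] by (simp only: t_def)
  have merge: "r powi a * r powi b = r powi c * r powi d" if "a + b = c + d" for a b c d
    using r that by (simp flip: power_int_add)
  have "((\<lambda>k. (1 + t\<^sup>2) * f k + (t * z) * f (k - 1) + (t / z) * f (k + 1)) has_sum
      (1 + t\<^sup>2) * P + (t * z) * P + (t / z) * P) UNIV"
    by (intro has_sum_add has_sum_cmult_right f f1 f2)
  also have "(1 + t\<^sup>2) * P + (t * z) * P + (t / z) * P = P * ((1 + z * t) * (1 + t / z))"
  proof -
    have "(1 + z * t) * (1 + t / z) = 1 + t\<^sup>2 + t * z + t / z"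
      using z by (simp add: field_simps power2_eq_square)
    then show ?thesis by (simp only: distrib_left distrib_right mult_ac)
  qed
  also have "\<dots> = (\<Prod>j<Suc n. (1 + z * r ^ (2 * j + 1)) * (1 + r ^ (2 * j + 1) / z))"
    by (simp add: P_def t_def)
  also have "(\<lambda>k. (1 + t\<^sup>2) * f k + (t * z) * f (k - 1) + (t / z) * f (k + 1)) =
      (\<lambda>k. central_qbinomial (r\<^sup>2) (Suc n) k * (r powi (k\<^sup>2) * z powi k))"
  proof
    fix k :: int
    have c: "(r\<^sup>2) powi m = r powi (2 * m)" for m
      by (simp add: power_int_mult)
    have e1: "t\<^sup>2 = r powi (2 * (2 * int n + 1))"
      unfolding tt by (metis mult.commute power_int_mult power_int_numeral)
    define X where "X = r powi (k\<^sup>2) * z powi k"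
    have "t * r powi ((k - 1)\<^sup>2) = r powi (2 * (int n + 1 - k)) * r powi (k\<^sup>2)"
      unfolding tt by (rule merge) (simp add: power2_eq_square algebra_simps)
    moreover have "z * z powi (k - 1) = z powi k" using z by (simp add: power_int_diff)
    moreover have "t * z * (r powi ((k - 1)\<^sup>2) * z powi (k - 1)) =
        (t * r powi ((k - 1)\<^sup>2)) * (z * z powi (k - 1))" by (simp only: mult_ac)
    ultimately have m1: "t * z * (r powi ((k - 1)\<^sup>2) * z powi (k - 1)) = r powi (2 * (int n + 1 - k)) * X"
      by (simp only: X_def mult.assoc)
    have "t * r powi ((k + 1)\<^sup>2) = r powi (2 * (int n + 1 + k)) * r powi (k\<^sup>2)"
      unfolding tt by (rule merge) (simp add: power2_eq_square algebra_simps)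
    moreover have "z powi (k + 1) / z = z powi k" using z by (simp add: power_int_add)
    moreover have "t / z * (r powi ((k + 1)\<^sup>2) * z powi (k + 1)) =
        (t * r powi ((k + 1)\<^sup>2)) * (z powi (k + 1) / z)" by simp
    ultimately have m2: "t / z * (r powi ((k + 1)\<^sup>2) * z powi (k + 1)) = r powi (2 * (int n + 1 + k)) * X"
      by (simp only: X_def mult.assoc)
    have "(1 + t\<^sup>2) * f k + (t * z) * f (k - 1) + (t / z) * f (k + 1) =
        (1 + t\<^sup>2) * (central_qbinomial (r\<^sup>2) n k * X) +
        central_qbinomial (r\<^sup>2) n (k - 1) * (t * z * (r powi ((k - 1)\<^sup>2) * z powi (k - 1))) +
        central_qbinomial (r\<^sup>2) n (k + 1) * (t / z * (r powi ((k + 1)\<^sup>2) * z powi (k + 1)))"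
      unfolding f_def X_def by (simp only: mult_ac)
    also have "\<dots> = central_qbinomial (r\<^sup>2) (Suc n) k * X"
      unfolding m1 m2 central_qbinomial_Suc[OF Q] c e1 by (simp only: distrib_left distrib_right mult_ac)
    finally show "(1 + t\<^sup>2) * f k + (t * z) * f (k - 1) + (t / z) * f (k + 1) =
        central_qbinomial (r\<^sup>2) (Suc n) k * (r powi (k\<^sup>2) * z powi k)"
      unfolding X_def .
  qed
  finally show ?case .
qed

definition euler_product :: "real \<Rightarrow> real" where
  "euler_product Q = (\<Prod>j. 1 - Q ^ Suc j)"

definition euler_product_plus :: "real \<Rightarrow> real" where
  "euler_product_plus Q = (\<Prod>j. 1 + Q ^ Suc j)"

lemma euler_product_limits:
  assumes Q: "0 < Q" "Q < 1"
  shows qfac_tendsto_euler: "qfac Q \<longlonglongrightarrow> euler_product Q" and euler_pos: "0 < euler_product Q"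
    and euler_plus_tendsto: "(\<lambda>n. \<Prod>j<n. 1 + Q ^ Suc j) \<longlonglongrightarrow> euler_product_plus Q"
    and euler_plus_pos: "0 < euler_product_plus Q"
proof -
  have s: "summable (\<lambda>j. Q ^ Suc j)"
    using Q by (subst summable_Suc_iff) (simp add: summable_geometric)
  have "abs_convergent_prod (\<lambda>j. 1 - Q ^ Suc j)" "abs_convergent_prod (\<lambda>j. 1 + Q ^ Suc j)"
    using s Q by (simp_all add: abs_convergent_prod_conv_summable abs_mult)
  then have 1: "(\<lambda>j. 1 - Q ^ Suc j) has_prod euler_product Q" and 2: "(\<lambda>j. 1 + Q ^ Suc j) has_prod euler_product_plus Q"
    unfolding euler_product_def euler_product_plus_def
    by (metis abs_convergent_prod_imp_convergent_prod convergent_prod_has_prod)+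
  show "qfac Q \<longlonglongrightarrow> euler_product Q" "(\<lambda>n. \<Prod>j<n. 1 + Q ^ Suc j) \<longlonglongrightarrow> euler_product_plus Q"
    using has_prod_imp_tendsto'[OF 1] has_prod_imp_tendsto'[OF 2] by (simp_all add: qfac_def [abs_def])
  show "0 < euler_product Q"
    by (rule has_prod_pos[OF 1]) (use Q in \<open>simp add: power_less_one_iff del: power_Suc\<close>)
  show "0 < euler_product_plus Q"
    by (rule has_prod_pos[OF 2]) (use Q in \<open>simp add: add_pos_pos\<close>)
qed

lemma qfac_antimono:
  assumes Q: "0 < Q" "Q < 1" and "m \<le> n"
  shows "qfac Q n \<le> qfac Q m"
  using \<open>m \<le> n\<close>
proof (induction rule: dec_induct)
  case (step n)
  have "qfac Q (Suc n) = qfac Q n * (1 - Q ^ Suc n)" by (simp add: qfac_def)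
  also have "\<dots> \<le> qfac Q n * 1"
    using qfac_pos[OF Q, of n] Q by (intro mult_left_mono) auto
  finally show ?case using step.IH by simp
qed simp

lemma euler_le_qfac:
  assumes Q: "0 < Q" "Q < 1"
  shows "euler_product Q \<le> qfac Q n"
  by (rule LIMSEQ_le_const2[OF qfac_tendsto_euler[OF Q]]) (auto intro: qfac_antimono[OF Q])

lemma central_qbinomial_nonneg:
  assumes Q: "0 < Q" "Q < 1"
  shows "0 \<le> central_qbinomial Q n k"
  using qfac_pos[OF Q] by (simp add: central_qbinomial_def inv_qfac_def less_imp_le)

lemma central_qbinomial_le:
  assumes Q: "0 < Q" "Q < 1"
  shows "central_qbinomial Q n k \<le> 1 / euler_product Q"
proof (cases "\<bar>k\<bar> \<le> int n")
  case False
  then have "central_qbinomial Q n k = 0" by (auto simp: central_qbinomial_def inv_qfac_def)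
  then show ?thesis using euler_pos[OF Q] by simp
next
  case True
  define i j where "i = nat (int n - k)" and "j = nat (int n + k)"
  have c: "central_qbinomial Q n k = qfac Q (2 * n) / (qfac Q i * qfac Q j)"
  proof -
    have "\<not> int n - k < 0" "\<not> int n + k < 0" using True by linarith+
    then show ?thesis by (simp only: central_qbinomial_def inv_qfac_def i_def j_def) (simp add: nat_mult_distrib)
  qed
  have "qfac Q (2 * n) \<le> qfac Q j"
    using True by (intro qfac_antimono[OF Q]) (auto simp: j_def)
  then have "qfac Q (2 * n) * euler_product Q \<le> qfac Q j * qfac Q i"
    using euler_le_qfac[OF Q, of i] euler_pos[OF Q] qfac_pos[OF Q, of j]
    by (intro mult_mono) auto
  then show ?thesis
    unfolding c using euler_pos[OF Q] qfac_pos[OF Q, of j] qfac_pos[OF Q, of i]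
    by (simp add: field_simps)
qed

lemma inv_qfac_tendsto:
  assumes Q: "0 < Q" "Q < 1"
  shows "(\<lambda>n. inv_qfac Q (int n + k)) \<longlonglongrightarrow> 1 / euler_product Q"
proof -
  have "filterlim (\<lambda>n. nat (int n + k)) sequentially sequentially"
    unfolding filterlim_at_top
  proof
    fix Z :: nat
    show "\<forall>\<^sub>F n in sequentially. Z \<le> nat (int n + k)"
      using eventually_ge_at_top[of "nat (int Z - k)"] by eventually_elim linarith
  qed
  then have "(\<lambda>n. 1 / qfac Q (nat (int n + k))) \<longlonglongrightarrow> 1 / euler_product Q"
    using euler_pos[OF Q]
    by (intro tendsto_divide tendsto_const filterlim_compose[OF qfac_tendsto_euler[OF Q]]) auto
  moreover have "\<forall>\<^sub>F n in sequentially. 1 / qfac Q (nat (int n + k)) = inv_qfac Q (int n + k)"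
    using eventually_ge_at_top[of "nat (- k)"] by eventually_elim (simp add: inv_qfac_def)
  ultimately show ?thesis by (rule Lim_transform_eventually)
qed

lemma central_qbinomial_tendsto:
  assumes Q: "0 < Q" "Q < 1"
  shows "(\<lambda>n. central_qbinomial Q n k) \<longlonglongrightarrow> 1 / euler_product Q"
proof -
  have "(\<lambda>n. inv_qfac Q (int (2 * n) + 0)) \<longlonglongrightarrow> 1 / euler_product Q"
    using LIMSEQ_subseq_LIMSEQ[OF inv_qfac_tendsto[OF Q, of 0], of "\<lambda>n. 2 * n"]
    by (simp add: strict_mono_def o_def)
  then have "(\<lambda>n. inv_qfac Q (int n + - k) * inv_qfac Q (int n + k) / inv_qfac Q (int (2 * n) + 0)) \<longlonglongrightarrow>
      (1 / euler_product Q) * (1 / euler_product Q) / (1 / euler_product Q)"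
    using euler_pos[OF Q] by (intro tendsto_mult tendsto_divide inv_qfac_tendsto[OF Q]) auto
  then show ?thesis using euler_pos[OF Q] by (simp add: central_qbinomial_def)
qed

text \<open>The limit of the finite version.  Since all terms are positive and the coefficients are bounded by their limit
\<open>1 / euler_product (r\<^sup>2)\<close>, the two inequalities between sum and product can be proved
separately, and summability need not be known in advance.\<close>

theorem jacobi_triple_product:
  assumes r: "0 < r" "r < 1" and z: "0 < z"
    and A: "(\<lambda>n. \<Prod>j<n. (1 + z * r ^ (2 * j + 1)) * (1 + r ^ (2 * j + 1) / z)) \<longlonglongrightarrow> A"
  shows "((\<lambda>k. r powi (k\<^sup>2) * z powi k) has_sum euler_product (r\<^sup>2) * A) UNIV"
proof -
  have Q: "0 < r\<^sup>2" "r\<^sup>2 < 1" using r by (auto simp: power_less_one_iff)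
  define E where "E = euler_product (r\<^sup>2)"
  have E: "E > 0" unfolding E_def by (rule euler_pos[OF Q])
  define P where "P n = (\<Prod>j<n. (1 + z * r ^ (2 * j + 1)) * (1 + r ^ (2 * j + 1) / z))" for n
  define c where "c k = r powi (k\<^sup>2) * z powi k" for k
  have c: "0 \<le> c k" for k using r z by (simp add: c_def)
  have P: "((\<lambda>k. central_qbinomial (r\<^sup>2) n k * c k) has_sum P n) UNIV" for n
    unfolding P_def c_def by (rule finite_triple_product[OF r z])
  have A: "P \<longlonglongrightarrow> A" using A by (simp add: P_def [abs_def])
  have fin: "sum c F \<le> E * A" if "finite F" for F
  proof -
    have "(\<lambda>n. \<Sum>k\<in>F. central_qbinomial (r\<^sup>2) n k * c k) \<longlonglongrightarrow> (\<Sum>k\<in>F. 1 / E * c k)"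
      unfolding E_def by (intro tendsto_sum tendsto_mult tendsto_const central_qbinomial_tendsto[OF Q])
    moreover have "(\<Sum>k\<in>F. central_qbinomial (r\<^sup>2) n k * c k) \<le> P n" for n
      using that by (intro finite_sum_le_has_sum[OF P]) (auto simp: c central_qbinomial_nonneg[OF Q])
    ultimately have "(\<Sum>k\<in>F. 1 / E * c k) \<le> A"
      by (intro LIMSEQ_le[OF _ A]) auto
    then show ?thesis using E by (simp add: field_simps flip: sum_divide_distrib)
  qed
  have "c summable_on UNIV"
    by (rule nonneg_bdd_above_summable_on) (auto simp: c intro!: bdd_aboveI2 fin)
  then obtain S where S: "(c has_sum S) UNIV" by (auto simp: summable_on_def)
  have "S \<le> E * A" using S by (rule has_sum_le_finite_sums) (auto intro: fin)
  moreover have "E * A \<le> S"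
  proof -
    have "P n \<le> 1 / E * S" for n
      unfolding E_def
      by (intro has_sum_mono[OF P has_sum_cmult_right[OF S]] mult_right_mono central_qbinomial_le[OF Q] c)
    then have "A \<le> 1 / E * S" by (intro LIMSEQ_le_const2[OF A]) auto
    then show ?thesis using E by (simp add: field_simps)
  qed
  ultimately show ?thesis using S by (simp add: E_def c_def [abs_def])
qed

lemma euler_product_square:
  assumes Q: "0 < Q" "Q < 1"
  shows "euler_product (Q\<^sup>2) = euler_product Q * euler_product_plus Q"
proof -
  have Q2: "0 < Q\<^sup>2" "Q\<^sup>2 < 1" using Q by (auto simp: power_less_one_iff)
  have "(\<lambda>n. qfac Q n * (\<Prod>j<n. 1 + Q ^ Suc j)) \<longlonglongrightarrow> euler_product Q * euler_product_plus Q"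
    by (intro tendsto_mult qfac_tendsto_euler euler_plus_tendsto Q)
  also have "(\<lambda>n. qfac Q n * (\<Prod>j<n. 1 + Q ^ Suc j)) = qfac (Q\<^sup>2)"
  proof
    fix n
    have "(1 - Q ^ Suc j) * (1 + Q ^ Suc j) = 1 - (Q\<^sup>2) ^ Suc j" for j
      by (simp only: power_mult [symmetric] square_diff_square_factored power2_eq_square) (simp add: algebra_simps power_mult_distrib)
    then show "qfac Q n * (\<Prod>j<n. 1 + Q ^ Suc j) = qfac (Q\<^sup>2) n"
      by (simp only: qfac_def prod.distrib [symmetric])
  qed
  finally show ?thesis by (rule LIMSEQ_unique[OF qfac_tendsto_euler[OF Q2]])
qed

text \<open>The triple product with \<open>z = r = s ^ 12\<close>.  One of its two product families starts with the
factor \<open>1 + 1\<close> and is otherwise equal to the other one.\<close>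

lemma theta_odd_product:
  assumes s: "0 < s" "s < 1"
  shows "theta 2 1 (s powi 3) = s ^ 3 * (2 * euler_product (s ^ 24) * (euler_product_plus (s ^ 24))\<^sup>2)"
proof -
  define q where "q = s ^ 24"
  have q: "0 < q" "q < 1" using s by (auto simp: q_def power_less_one_iff)
  have r: "0 < s ^ 12" "s ^ 12 < 1" and s3: "0 < s powi 3" "s powi 3 < 1"
    using s by (auto simp: power_less_one_iff)
  define G where "G = (\<lambda>n. \<Prod>j<n. 1 + q ^ Suc j)"
  have G: "G \<longlonglongrightarrow> euler_product_plus q" unfolding G_def by (rule euler_plus_tendsto[OF q])
  have "(\<lambda>n. \<Prod>j<Suc n. 1 + q ^ j) \<longlonglongrightarrow> 2 * euler_product_plus q"
    unfolding prod.lessThan_Suc_shift using tendsto_mult[OF tendsto_const G, of 2] by (simp add: G_def)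
  then have G': "(\<lambda>n. \<Prod>j<n. 1 + q ^ j) \<longlonglongrightarrow> 2 * euler_product_plus q"
    by (rule LIMSEQ_imp_Suc)
  have f: "(1 + s ^ 12 * (s ^ 12) ^ (2 * j + 1)) * (1 + (s ^ 12) ^ (2 * j + 1) / s ^ 12) = (1 + q ^ Suc j) * (1 + q ^ j)" for j
  proof -
    have "s ^ 12 * (s ^ 12) ^ (2 * j + 1) = q ^ Suc j"
      unfolding q_def power_mult [symmetric] power_add [symmetric] by (simp add: algebra_simps)
    moreover have "(s ^ 12) ^ (2 * j + 1) / s ^ 12 = q ^ j"
      using s by (simp add: q_def power_add flip: power_mult)
    ultimately show ?thesis by simp
  qed
  have "((\<lambda>k. (s ^ 12) powi (k\<^sup>2) * (s ^ 12) powi k) has_sum euler_product ((s ^ 12)\<^sup>2) * (euler_product_plus q * (2 * euler_product_plus q))) UNIV"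
  proof (rule jacobi_triple_product[OF r r(1)])
    show "(\<lambda>n. \<Prod>j<n. (1 + s ^ 12 * (s ^ 12) ^ (2 * j + 1)) * (1 + (s ^ 12) ^ (2 * j + 1) / s ^ 12)) \<longlonglongrightarrow>
        euler_product_plus q * (2 * euler_product_plus q)"
      unfolding f prod.distrib using tendsto_mult[OF G G'] by (simp add: G_def)
  qed
  from has_sum_cmult_right[OF this, of "s ^ 3"]
  have "((\<lambda>k. s ^ 3 * ((s ^ 12) powi (k\<^sup>2) * (s ^ 12) powi k)) has_sum
      s ^ 3 * (2 * euler_product q * (euler_product_plus q)\<^sup>2)) UNIV"
    by (simp add: q_def mult_ac power2_eq_square flip: power_mult)
  also have "(\<lambda>k. s ^ 3 * ((s ^ 12) powi (k\<^sup>2) * (s ^ 12) powi k)) = (\<lambda>k. (s powi 3) powi ((2 * k + 1)\<^sup>2))"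
  proof
    fix k :: int
    have "(s powi 3) powi ((2 * k + 1)\<^sup>2) = s powi (3 * (2 * k + 1)\<^sup>2)" by (simp add: power_int_mult)
    also have "3 * (2 * k + 1)\<^sup>2 = 3 + (12 * k\<^sup>2 + 12 * k)" by (simp add: power2_eq_square algebra_simps)
    also have "s powi \<dots> = s powi 3 * (s powi (12 * k\<^sup>2) * s powi (12 * k))"
      using s by (simp add: power_int_add)
    finally show "s ^ 3 * ((s ^ 12) powi (k\<^sup>2) * (s ^ 12) powi k) = (s powi 3) powi ((2 * k + 1)\<^sup>2)"
      by (simp add: power_int_mult)
  qed
  finally show ?thesis
    unfolding q_def by (rule has_sum_unique[rotated]) (rule has_sum_theta[OF s3], simp)
qed

text \<open>The triple product with \<open>r = s ^ 36\<close> and \<open>z = s ^ 12\<close>.  Its factors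
\<open>1 + q ^ j\<close>, where \<open>q = s ^ 24\<close>, run through all \<open>j\<close> that are
not divisible by three.\<close>

lemma theta_6_1_product:
  assumes s: "0 < s" "s < 1"
  shows "theta 6 1 s = s * (euler_product (s ^ 72) * euler_product_plus (s ^ 24) / euler_product_plus (s ^ 72))"
proof -
  define q where "q = s ^ 24"
  have q: "0 < q" "q < 1" using s by (auto simp: q_def power_less_one_iff)
  have q3: "0 < q ^ 3" "q ^ 3 < 1" using q by (auto simp: power_less_one_iff)
  have r: "0 < s ^ 36" "s ^ 36 < 1" "0 < s ^ 12"
    using s by (auto simp: power_less_one_iff)
  define G where "G = (\<lambda>n. \<Prod>j<n. 1 + q ^ Suc j)"
  define H where "H = (\<lambda>n. \<Prod>j<n. 1 + (q ^ 3) ^ Suc j)"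
  have H: "H \<longlonglongrightarrow> euler_product_plus (q ^ 3)" unfolding H_def by (rule euler_plus_tendsto[OF q3])
  have "G \<longlonglongrightarrow> euler_product_plus q" unfolding G_def by (rule euler_plus_tendsto[OF q])
  then have G: "(\<lambda>n. G (3 * n)) \<longlonglongrightarrow> euler_product_plus q"
    using LIMSEQ_subseq_LIMSEQ[of G _ "\<lambda>n. 3 * n"] by (simp add: strict_mono_def o_def)
  define A where "A = (\<lambda>n. \<Prod>j<n. (1 + q ^ (3 * j + 2)) * (1 + q ^ (3 * j + 1)))"
  have "G (3 * n) = A n * H n" for n
  proof (induction n)
    case (Suc n)
    have "3 * Suc n = Suc (Suc (Suc (3 * n)))" by simp
    then have "G (3 * Suc n) = G (3 * n) * (1 + q ^ Suc (3 * n)) * (1 + q ^ Suc (Suc (3 * n))) * (1 + q ^ Suc (Suc (Suc (3 * n))))"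
      by (simp only: G_def prod.lessThan_Suc)
    moreover have "(q ^ 3) ^ Suc n = q ^ Suc (Suc (Suc (3 * n)))"
      unfolding power_mult [symmetric] by (rule arg_cong) simp
    ultimately show ?case using Suc.IH by (simp add: A_def H_def)
  qed (simp add: G_def A_def H_def)
  moreover have "H n > 0" for n
    unfolding H_def using q3 by (intro prod_pos) (simp add: add_pos_pos)
  ultimately have "A n = G (3 * n) / H n" for n by (simp add: less_imp_neq[symmetric])
  then have AGH: "A = (\<lambda>n. G (3 * n) / H n)" by blast
  then have A: "A \<longlonglongrightarrow> euler_product_plus q / euler_product_plus (q ^ 3)"
    unfolding AGH using euler_plus_pos[OF q3] by (intro tendsto_divide G H) simp
  have f: "(1 + s ^ 12 * (s ^ 36) ^ (2 * j + 1)) * (1 + (s ^ 36) ^ (2 * j + 1) / s ^ 12) =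
      (1 + q ^ (3 * j + 2)) * (1 + q ^ (3 * j + 1))" for j
  proof -
    have "s ^ 12 * (s ^ 36) ^ (2 * j + 1) = q ^ (3 * j + 2)"
      unfolding q_def power_mult [symmetric] power_add [symmetric] by (simp add: algebra_simps)
    moreover have e: "(s ^ 36) ^ (2 * j + 1) = s ^ 12 * q ^ (3 * j + 1)"
      unfolding q_def power_mult [symmetric] power_add [symmetric] by (simp add: algebra_simps)
    have "(s ^ 36) ^ (2 * j + 1) / s ^ 12 = q ^ (3 * j + 1)"
      unfolding e using r(3) by simp
    ultimately show ?thesis by (simp only:)
  qed
  have "((\<lambda>k. (s ^ 36) powi (k\<^sup>2) * (s ^ 12) powi k) has_sum
      euler_product ((s ^ 36)\<^sup>2) * (euler_product_plus q / euler_product_plus (q ^ 3))) UNIV"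
  proof (rule jacobi_triple_product[OF r])
    show "(\<lambda>n. \<Prod>j<n. (1 + s ^ 12 * (s ^ 36) ^ (2 * j + 1)) * (1 + (s ^ 36) ^ (2 * j + 1) / s ^ 12)) \<longlonglongrightarrow>
        euler_product_plus q / euler_product_plus (q ^ 3)"
      unfolding f using A by (simp add: A_def)
  qed
  from has_sum_cmult_right[OF this, of s]
  have "((\<lambda>k. s * ((s ^ 36) powi (k\<^sup>2) * (s ^ 12) powi k)) has_sum
      s * (euler_product (s ^ 72) * euler_product_plus (s ^ 24) / euler_product_plus (s ^ 72))) UNIV"
    by (simp add: q_def flip: power_mult)
  also have "(\<lambda>k. s * ((s ^ 36) powi (k\<^sup>2) * (s ^ 12) powi k)) = (\<lambda>k. s powi ((6 * k + 1)\<^sup>2))"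
  proof
    fix k :: int
    have "(6 * k + 1)\<^sup>2 = 1 + (36 * k\<^sup>2 + 12 * k)" by (simp add: power2_eq_square algebra_simps)
    also have "s powi \<dots> = s powi 1 * (s powi (36 * k\<^sup>2) * s powi (12 * k))"
      using s by (simp add: power_int_add)
    finally show "s * ((s ^ 36) powi (k\<^sup>2) * (s ^ 12) powi k) = s powi ((6 * k + 1)\<^sup>2)"
      by (simp add: power_int_mult)
  qed
  finally show ?thesis
    by (rule has_sum_unique[rotated]) (rule has_sum_theta[OF s], simp)
qed

lemma theta_6_3: 
  "theta 6 3 s = theta 2 1 ((s ^ 3) powi 3)"
proof -
  have "s powi ((6 * i + 3)\<^sup>2) = ((s ^ 3) powi 3) powi ((2 * i + 1)\<^sup>2)" for i
  proof -
    have "(6 * i + 3)\<^sup>2 = 9 * (2 * i + 1)\<^sup>2" by (simp add: power2_eq_square algebra_simps)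
    then show ?thesis by (simp add: power_int_mult flip: power_mult)
  qed
  then show ?thesis by (simp add: theta_def)
qed

text \<open>All six series are products of powers of \<open>s\<close> and of \<^const>\<open>euler_product\<close> and
\<^const>\<open>euler_product_plus\<close> at powers of \<open>s ^ 24\<close>.  The relation
\<open>euler_product_square\<close> between \<open>q\<close> and \<open>q\<^sup>2\<close> makes the two sides
agree.\<close>

lemma theta_duplication:
  assumes s: "0 < s" "s < 1"
  shows "2 * (theta 6 1 (s\<^sup>2))\<^sup>2 * theta 6 3 (s\<^sup>2) * theta 2 1 (s powi 3) =
    theta 2 1 ((s\<^sup>2) powi 3) * theta 6 1 s * (theta 6 3 s)\<^sup>2"
proof -
  define q where "q = s ^ 24"
  have q: "0 < q" "q < 1" using s by (auto simp: q_def power_less_one_iff)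
  have q3: "0 < q ^ 3" "q ^ 3 < 1" using q by (auto simp: power_less_one_iff)
  have q6: "0 < q ^ 6" "q ^ 6 < 1" using q by (auto simp: power_less_one_iff)
  have s2: "0 < s\<^sup>2" "s\<^sup>2 < 1" and s3: "0 < s ^ 3" "s ^ 3 < 1" and s6: "0 < s ^ 6" "s ^ 6 < 1"
    using s by (auto simp: power_less_one_iff)
  define E G where "E = euler_product q" and "G = euler_product_plus q"
  define E3 G3 where "E3 = euler_product (q ^ 3)" and "G3 = euler_product_plus (q ^ 3)"
  define G2 G6 where "G2 = euler_product_plus (q\<^sup>2)" and "G6 = euler_product_plus (q ^ 6)"
  have nz: "G3 \<noteq> 0" "G6 \<noteq> 0" using euler_plus_pos[OF q3] euler_plus_pos[OF q6] by (auto simp: G3_def G6_def)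
  have E2: "euler_product (q\<^sup>2) = E * G" unfolding E_def G_def by (rule euler_product_square[OF q])
  have E6: "euler_product (q ^ 6) = E3 * G3"
    using euler_product_square[OF q3] by (simp add: E3_def G3_def flip: power_mult)
  have x: "theta 2 1 (s powi 3) = s ^ 3 * (2 * E * G\<^sup>2)"
    using theta_odd_product[OF s] by (simp add: E_def G_def q_def)
  have x2: "theta 2 1 ((s\<^sup>2) powi 3) = s ^ 6 * (2 * (E * G) * G2\<^sup>2)"
    using theta_odd_product[OF s2] by (simp add: E2 [symmetric] G2_def q_def flip: power_mult)
  have p: "theta 6 1 s = s * (E3 * G / G3)"
    using theta_6_1_product[OF s] by (simp add: E3_def G_def G3_def q_def flip: power_mult)
  have p2: "theta 6 1 (s\<^sup>2) = s\<^sup>2 * ((E3 * G3) * G2 / G6)"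
    using theta_6_1_product[OF s2] by (simp add: E6 [symmetric] G2_def G6_def q_def flip: power_mult)
  have y: "theta 6 3 s = s ^ 9 * (2 * E3 * G3\<^sup>2)"
    using theta_odd_product[OF s3] unfolding theta_6_3 by (simp add: E3_def G3_def q_def flip: power_mult)
  have y2: "theta 6 3 (s\<^sup>2) = s ^ 18 * (2 * (E3 * G3) * G6\<^sup>2)"
    using theta_odd_product[OF s6] unfolding theta_6_3 by (simp add: E6 [symmetric] G6_def q_def flip: power_mult)
  show ?thesis
    unfolding x x2 p p2 y y2 using nz by (simp add: field_simps) (simp add: power_numeral_reduce algebra_simps)
qed

section \<open>The Hecke relation at 2\<close>

text \<open>Let \<open>T\<close> be the odd part of the series at \<open>h\<close>.  Then the left side is
\<open>2 * H ^ 3 + 6 * H * T\<^sup>2\<close> with \<open>H\<close> the series at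
\<open>h ^ 4\<close>, and the relation for \<open>x ^ 4\<close> is exactly what converts
\<open>H * T\<^sup>2\<close> into a sum of two cubes.\<close>

lemma hex_series_cubes:
  assumes h: "0 < h" "h < 1"
  shows "hex_series h ^ 3 + hex_series (- h) ^ 3 = 6 * hex_series (h\<^sup>2) ^ 3 + 8 * hex_series (h ^ 4) ^ 3"
proof -
  define s where "s = root 4 h"
  have s: "0 < s" "s < 1" and sh: "s ^ 4 = h" using h by (auto simp: s_def)
  have s2: "0 < s\<^sup>2" "s\<^sup>2 < 1" using s by (auto simp: power_less_one_iff)
  have h2: "s ^ 8 = h\<^sup>2" and h4: "s ^ 16 = h ^ 4" unfolding sh [symmetric] by (simp_all flip: power_mult)
  define x p y where "x = theta 2 1 (s powi 3)" and "p = theta 6 1 s" and "y = theta 6 3 s"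
  define x2 p2 y2 where "x2 = theta 2 1 ((s\<^sup>2) powi 3)" and "p2 = theta 6 1 (s\<^sup>2)" and "y2 = theta 6 3 (s\<^sup>2)"
  have pos: "0 < x" "0 < x2"
    using s s2 by (auto simp: x_def x2_def power_less_one_iff intro!: theta_pos)
  have A: "3 * p\<^sup>2 * y = x * hex_series (h\<^sup>2)"
    using theta_triple_eq_theta_hex_series[OF s] by (simp add: p_def y_def x_def h2)
  have A2: "3 * p2\<^sup>2 * y2 = x2 * hex_series (h ^ 4)"
    using theta_triple_eq_theta_hex_series[OF s2] by (simp add: p2_def y2_def x2_def h4 flip: power_mult)
  have J: "2 * p2\<^sup>2 * y2 * x = x2 * p * y\<^sup>2"
    using theta_duplication[OF s] unfolding x_def p_def y_def x2_def p2_def y2_def .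
  have O: "3 * (x * p) = 2 * (hex_series h - hex_series (h ^ 4))"
    using theta_pair_eq_odd_hex_series[OF s] by (simp add: x_def p_def sh h4)
  have F: "x ^ 4 = 8 * p ^ 3 * y + y ^ 4"
    using theta_odd_fourth_power[OF s] by (simp add: x_def p_def y_def)
  have "2 * x * (3 * p2\<^sup>2 * y2) = 3 * (2 * p2\<^sup>2 * y2 * x)" by (simp add: algebra_simps)
  then have "x2 * (2 * x * hex_series (h ^ 4)) = x2 * (3 * p * y\<^sup>2)"
    unfolding A2 J by (simp only: mult_ac)
  then have H16: "hex_series (h ^ 4) = 3 * p * y\<^sup>2 / (2 * x)" using pos by (simp add: eq_divide_eq mult_ac)
  have H8: "hex_series (h\<^sup>2) = 3 * p\<^sup>2 * y / x" using A pos by (simp add: field_simps)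
  have u: "hex_series (- h) = 2 * hex_series (h ^ 4) - hex_series h" using h by (intro hex_series_uminus) auto
  define H where "H = hex_series (h ^ 4)"
  have H: "H = 3 * p * y\<^sup>2 / (2 * x)" unfolding H_def by (rule H16)
  define T where "T = 3 / 2 * (x * p)"
  have "2 * T = 3 * (x * p)" by (simp add: T_def)
  then have "T = hex_series h - H" unfolding O H_def by simp
  then have HT: "hex_series h = H + T" "hex_series (- h) = H - T" using u by (simp_all add: H_def)
  have "hex_series h ^ 3 + hex_series (- h) ^ 3 = 2 * H ^ 3 + 6 * (H * T\<^sup>2)"
    unfolding HT by (simp add: power_numeral_reduce algebra_simps)
  also have "H * T\<^sup>2 = 27 / 8 * (p ^ 3 * y\<^sup>2 * x)"
    unfolding H T_def using pos by (simp add: power_numeral_reduce field_simps)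
  also have "\<dots> = 27 / 8 * (p ^ 3 * y\<^sup>2 * x ^ 4 / x ^ 3)"
    using pos by (simp add: power_numeral_reduce field_simps)
  also have "\<dots> = hex_series (h\<^sup>2) ^ 3 + H ^ 3"
    unfolding F H H8 using pos by (simp add: power_numeral_reduce field_simps)
  finally show ?thesis by (simp add: H_def)
qed

lemma B3_sums:
  assumes g: "\<bar>g\<bar> < 1"
  shows "(\<lambda>n. real (B3 n) * (g ^ 3) ^ Suc n) sums (hex_series g / 3) ^ 3"
proof -
  define f where "f p = g ^ (3 * sum_list p + 1)" for p :: "nat list"
  define K where "K = {p. is_core 3 p}"
  have e: "3 * int (sum_list p) + 1 = int (3 * sum_list p + 1)" for p by simp
  have "g powi (3 * int (sum_list p) + 1) = f p" for p
    unfolding e f_def by (rule power_int_of_nat)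
  then have f: "(f has_sum hex_series g / 3) K"
    using has_sum_cores[OF g] by (simp only: K_def)
  have "((\<lambda>(p, q, r). f p * (f q * f r)) has_sum (hex_series g / 3) ^ 3) (K \<times> K \<times> K)"
    using has_sum_times[OF f has_sum_times[OF f f]] by (simp add: case_prod_unfold power3_eq_cube mult.assoc)
  also have "?this \<longleftrightarrow> ((\<lambda>(n, _). (g ^ 3) ^ Suc n) has_sum (hex_series g / 3) ^ 3) (Sigma UNIV core3_triples)"
  proof (rule has_sum_reindex_bij_witness[where i = snd and
        j = "\<lambda>(p, q, r). (sum_list p + sum_list q + sum_list r, (p, q, r))"], goal_cases)
    case (5 a)
    obtain p q r where a: "a = (p, q, r)" by (cases a)
    have "f p * (f q * f r) = g ^ ((3 * sum_list p + 1) + ((3 * sum_list q + 1) + (3 * sum_list r + 1)))"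
      by (simp only: f_def power_add)
    also have "\<dots> = g ^ (3 * Suc (sum_list p + sum_list q + sum_list r))"
      by (rule arg_cong) simp
    finally show ?case by (simp only: a prod.case power_mult)
  qed (auto simp: K_def core3_triples_def)
  finally have "((\<lambda>n. real (B3 n) * (g ^ 3) ^ Suc n) has_sum (hex_series g / 3) ^ 3) UNIV"
  proof (rule has_sum_SigmaD)
    show "((\<lambda>y. case (n, y) of (n, _) \<Rightarrow> (g ^ 3) ^ Suc n) has_sum real (B3 n) * (g ^ 3) ^ Suc n) (core3_triples n)" for n
      by (rule has_sum_finiteI) (simp_all add: finite_core3_triples B3_def)
  qed
  then show ?thesis by (rule has_sum_imp_sums)
qed

text \<open>Nonzero power series have isolated zeros, so vanishing to the right of the origin is enough.\<close>

lemma zero_power_series: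
  fixes d :: "nat \<Rightarrow> real"
  assumes d: "\<And>t. 0 < t \<Longrightarrow> t < 1 \<Longrightarrow> (\<lambda>m. d m * t ^ m) sums 0" and "d 0 = 0"
  shows "d m = 0"
proof (rule ccontr)
  assume m: "d m \<noteq> 0"
  then have "m > 0" using \<open>d 0 = 0\<close> by (cases m) auto
  define f where "f x = (\<Sum>m. d m * x ^ m)" for x
  have "(\<lambda>m. d m * (x - 0) ^ m) sums f x" if "norm (x - 0) < 1" for x
  proof -
    define t where "t = (\<bar>x\<bar> + 1) / 2"
    have t: "\<bar>x\<bar> < t" "0 < t" "t < 1" using that by (auto simp: t_def)
    have "summable (\<lambda>m. d m * t ^ m)"
      using d[OF t(2,3)] by (rule sums_summable)
    then have "summable (\<lambda>m. d m * x ^ m)"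
      by (rule powser_inside) (use t in simp)
    then show ?thesis by (simp add: f_def summable_sums)
  qed
  moreover have "f 0 = 0" using \<open>d 0 = 0\<close> by (simp add: f_def powser_zero)
  ultimately obtain s where s: "0 < s" "\<And>z. z \<in> cball 0 s - {0} \<Longrightarrow> f z \<noteq> 0"
    using powser_0_nonzero[of 1 0 d f m] m \<open>m > 0\<close> by auto
  define t where "t = min s (1 / 2)"
  have t: "0 < t" "t < 1" "t \<in> cball 0 s - {0}" using s(1) by (auto simp: t_def)
  then show False using s(2)[OF t(3)] d[OF t(1,2)] by (simp add: f_def sums_iff)
qed

text \<open>With the shift, the index is a third of a sum of three values of \<^const>\<open>hex_form\<close>, and the
Hecke relation at 2 relates the indices \<open>2 * m\<close>, \<open>m\<close> and \<open>m / 2\<close>.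
The value 0 at \<open>m = 0\<close> is the vanishing constant term of the series.\<close>

definition B3_pred :: "nat \<Rightarrow> real" where
  "B3_pred m = (if m = 0 then 0 else real (B3 (m - 1)))"

lemma B3_pred_sums:
  assumes g: "\<bar>g\<bar> < 1"
  shows "(\<lambda>m. B3_pred m * (g ^ 3) ^ m) sums (hex_series g / 3) ^ 3"
  using sums_Suc[of "\<lambda>m. B3_pred m * (g ^ 3) ^ m"] B3_sums[OF g] by (simp add: B3_pred_def)

text \<open>The coefficient of \<open>t ^ (2 * m)\<close> in \<open>hex_series_cubes\<close> with
\<open>t = h ^ 3\<close>.  Adding the series at \<open>- h\<close> doubles the even coefficients and
removes the odd ones.\<close>

lemma B3_pred_hecke: "B3_pred (2 * m) = 3 * B3_pred m + (if even m then 4 * B3_pred (m div 2) else 0)"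
proof -
  define d where "d = (\<lambda>m. B3_pred m * (1 + (- 1) ^ m) - 6 * (if even m then B3_pred (m div 2) else 0)
      - 8 * (if 4 dvd m then B3_pred (m div 4) else 0))"
  have "d (2 * m) = 0"
  proof (rule zero_power_series)
    fix t :: real assume t: "0 < t" "t < 1"
    define h where "h = root 3 t"
    have h: "0 < h" "h < 1" and th: "h ^ 3 = t" using t by (auto simp: h_def)
    have "\<bar>h\<bar> < 1" "\<bar>- h\<bar> < 1" "\<bar>h\<^sup>2\<bar> < 1" "\<bar>h ^ 4\<bar> < 1" using h by (auto simp: power_less_one_iff)
    note S = this[THEN B3_pred_sums]
    have "(h\<^sup>2) ^ 3 = t\<^sup>2" "(h ^ 4) ^ 3 = t ^ 4" "(- h) ^ 3 = - t"
      unfolding th [symmetric] by (simp_all flip: power_mult)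
    note S = S[unfolded this th]
    have S3: "(\<lambda>m. (if even m then B3_pred (m div 2) else 0) * t ^ m) sums (hex_series (h\<^sup>2) / 3) ^ 3"
      by (subst sums_mono_reindex[of "\<lambda>m. 2 * m", symmetric])
         (use S(3) in \<open>auto simp: strict_mono_def power_mult elim!: evenE\<close>)
    have S4: "(\<lambda>m. (if 4 dvd m then B3_pred (m div 4) else 0) * t ^ m) sums (hex_series (h ^ 4) / 3) ^ 3"
      by (subst sums_mono_reindex[of "\<lambda>m. 4 * m", symmetric])
         (use S(4) in \<open>auto simp: strict_mono_def power_mult elim!: dvdE\<close>)
    have "(\<lambda>m. (B3_pred m * t ^ m + B3_pred m * (- t) ^ m) - 6 * ((if even m then B3_pred (m div 2) else 0) * t ^ m)
        - 8 * ((if 4 dvd m then B3_pred (m div 4) else 0) * t ^ m)) sums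
      (((hex_series h / 3) ^ 3 + (hex_series (- h) / 3) ^ 3) - 6 * (hex_series (h\<^sup>2) / 3) ^ 3 - 8 * (hex_series (h ^ 4) / 3) ^ 3)"
      by (intro sums_diff sums_add sums_mult S(1,2) S3 S4)
    moreover have "((hex_series h / 3) ^ 3 + (hex_series (- h) / 3) ^ 3) - 6 * (hex_series (h\<^sup>2) / 3) ^ 3 - 8 * (hex_series (h ^ 4) / 3) ^ 3 = 0"
      using hex_series_cubes[OF h] by (simp add: power_divide)
    moreover have "(B3_pred m * t ^ m + B3_pred m * (- t) ^ m) - 6 * ((if even m then B3_pred (m div 2) else 0) * t ^ m)
        - 8 * ((if 4 dvd m then B3_pred (m div 4) else 0) * t ^ m) = d m * t ^ m" for m
      unfolding d_def power_minus[of t m] left_diff_distrib distrib_left by (simp add: algebra_simps)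
    ultimately show "(\<lambda>m. d m * t ^ m) sums 0" by (simp only:)
  qed (simp add: d_def B3_pred_def)
  moreover have "4 dvd 2 * m \<longleftrightarrow> even m" "2 * m div 4 = m div 2" by presburger+
  then have "d (2 * m) = B3_pred (2 * m) * 2 - 6 * B3_pred m - 8 * (if even m then B3_pred (m div 2) else 0)"
    by (simp only: d_def) simp
  moreover have "(if even m then 4 * B3_pred (m div 2) else 0) = 4 * (if even m then B3_pred (m div 2) else 0)"
    by simp
  ultimately show ?thesis by linarith
qed

text \<open>The characteristic polynomial of the recurrence has the roots 4 and -1.\<close>

lemma hecke_recurrence:
  fixes u :: "nat \<Rightarrow> real"
  assumes "\<And>k. u (Suc (Suc k)) = 3 * u (Suc k) + 4 * u k"
  shows "u (Suc k) = (2 ^ (2 * k + 2) + (- 1) ^ k) / 5 * u 1 + (2 ^ (2 * k + 2) - 4 * (- 1) ^ k) / 5 * u 0"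
proof (induction k rule: induct_nat_012)
  case (ge2 k)
  show ?case unfolding assms[of "Suc k"] ge2.IH by (simp add: field_simps)
qed (simp_all add: assms)

theorem theorem2p1:
  fixes k n :: nat
  assumes "k \<ge> 1"
  shows "real (B3 (2 ^ (k + 1) * n + 2 ^ k - 1))
           = (2 ^ (2 * k + 2) + (-1) ^ k) / 5 * real (B3 (2 * n))
         \<and> real (B3 (2 ^ (k + 1) * n + 2 ^ (k + 1) - 1))
           = (2 ^ (2 * k + 2) + (-1) ^ k) / 5 * real (B3 (2 * n + 1))
             + (2 ^ (2 * k + 2) - 4 * (-1) ^ k) / 5 * real (B3 n)"
proof
  have rec: "B3_pred (2 ^ Suc (Suc k) * m) = 3 * B3_pred (2 ^ Suc k * m) + 4 * B3_pred (2 ^ k * m)" for k m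
    using B3_pred_hecke[of "2 ^ Suc k * m"] by (simp add: mult.assoc)
  have B: "real (B3 l) = B3_pred (Suc l)" for l by (simp add: B3_pred_def)
  obtain j where k: "k = Suc j" using assms by (cases k) auto
  have "Suc (2 ^ (k + 1) * n + 2 ^ k - 1) = 2 ^ Suc j * (2 * n + 1)"
    by (simp add: k algebra_simps)
  then have "real (B3 (2 ^ (k + 1) * n + 2 ^ k - 1)) = B3_pred (2 ^ Suc j * (2 * n + 1))"
    unfolding B by (simp only:)
  also have "\<dots> = (2 ^ (2 * j + 2) + (- 1) ^ j) / 5 * B3_pred (2 ^ 1 * (2 * n + 1))
      + (2 ^ (2 * j + 2) - 4 * (- 1) ^ j) / 5 * B3_pred (2 ^ 0 * (2 * n + 1))"
    by (rule hecke_recurrence) (rule rec)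
  also have "B3_pred (2 ^ 1 * (2 * n + 1)) = 3 * B3_pred (2 * n + 1)"
    using B3_pred_hecke[of "2 * n + 1"] by simp
  also have "B3_pred (2 ^ 0 * (2 * n + 1)) = B3_pred (2 * n + 1)" by simp
  also have "B3_pred (2 * n + 1) = real (B3 (2 * n))" by (simp add: B3_pred_def)
  also have "(2 ^ (2 * j + 2) + (- 1) ^ j) / 5 * (3 * real (B3 (2 * n)))
      + (2 ^ (2 * j + 2) - 4 * (- 1) ^ j) / 5 * real (B3 (2 * n))
      = (2 ^ (2 * k + 2) + (-1) ^ k) / 5 * real (B3 (2 * n))"
    by (simp add: k field_simps)
  finally show "real (B3 (2 ^ (k + 1) * n + 2 ^ k - 1))
      = (2 ^ (2 * k + 2) + (-1) ^ k) / 5 * real (B3 (2 * n))" .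
  have "Suc (2 ^ (k + 1) * n + 2 ^ (k + 1) - 1) = 2 ^ Suc k * Suc n"
    by (simp add: algebra_simps)
  then have "real (B3 (2 ^ (k + 1) * n + 2 ^ (k + 1) - 1)) = B3_pred (2 ^ Suc k * Suc n)"
    unfolding B by (simp only:)
  also have "\<dots> = (2 ^ (2 * k + 2) + (- 1) ^ k) / 5 * B3_pred (2 ^ 1 * Suc n)
      + (2 ^ (2 * k + 2) - 4 * (- 1) ^ k) / 5 * B3_pred (2 ^ 0 * Suc n)"
    by (rule hecke_recurrence) (rule rec)
  finally show "real (B3 (2 ^ (k + 1) * n + 2 ^ (k + 1) - 1))
           = (2 ^ (2 * k + 2) + (-1) ^ k) / 5 * real (B3 (2 * n + 1))
             + (2 ^ (2 * k + 2) - 4 * (-1) ^ k) / 5 * real (B3 n)"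
    unfolding B by simp
qed

end
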